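(* Let $k\ge2$ and $w\ge1$, let $n:=w+k+1$ and $g:=\gcd(k,n)$, and let $K=\mathbb{F}_q$ be a finite field with $q$ elements. (1) If $g=1$, the number of tame $\mathrm{SL}_k$-frieze patterns of width $w$ over $K$ is $\dfrac{|C_k(n)|}{|\mathrm{PGL}(k,K)|}$. (2) If $g>1$, the number of tame $\mathrm{SL}_k$-frieze patterns of width $w$ over $K$ is $\dfrac{|C_k^*(n)|\,(q-1)^{g-1}}{|\mathrm{PGL}(k,K)|}$.
   Context: A tame $\mathrm{SL}_k$-frieze pattern of width $w$ over a field $K$ (with $n=w+k+1$) is a family of elements $e_j(i)\in K$, $i\in\mathbb{Z}$, $j\in\{-k+1,\dots,n-1\}$, such that $e_j(i)=0$ for $-k+1\le j\le-1$ and for $w+2\le j\le n-1$, $e_0(i)=e_{w+1}(i)=1$ for all $i$, and: (a) every $k\times k$ diamond $(e_{j+c-r}(i+r))_{0\le r,c\le k-1}$ all of whose indices $j+c-r$ lie in $\{-k+1,\dots,n-1\}$ has determinant $1$; (b) every $(k+1)\times(k+1)$ diamond $(e_{j+c-r}(i+r))_{0\le r,c\le k}$ all of whose indices lie in $\{-k+1,\dots,n-1\}$ has determinant $0$. (In the usual picture, row $j$ consists of the $e_j(i)$; $e_{j-1}(i+1)$ lies south-east and $e_{j+1}(i)$ north-east of $e_j(i)$; the rows $j=1,\dots,w$ are the nontrivial rows.) $C_k(n)$ is the set of tuples $(v_1,\dots,v_n)\in(\mathbb{P}^{k-1}(K))^n$ such that for every $i\in[n]$, $v_i,\dots,v_{i+k-1}$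 are projectively independent (indices mod $n$). For $g>1$, $C_k^*(n)$ is the set of $v\in C_k(n)$ such that for a (any) lift $(V_1,\dots,V_n)$, with $d_i=\det(V_i,\dots,V_{i+k-1})$ (indices mod $n$), one has $d_id_{i+g}\cdots d_{i+n-g}=d_{i+1}d_{i+g+1}\cdots d_{i+n-g+1}$ for all $i\in\{1,\dots,g-1\}$.
   Formalization: In the definition of C_k^*(n), the lifts in d_i are continued past n by V_{i+n} = (-1)^{k-1} V_i rather than V_{i+n} = V_i; with unsigned indices mod n, part (2) fails, e.g. for k=2, w=1, q=3 (2 friezes, but the formula gives 5). *)

theory Defs
  imports
    "HOL-Library.FuncSet"
    "HOL-Library.Cardinality"
    "HOL-Algebra.Coset"
    "Jordan_Normal_Form.Matrix"
    "Jordan_Normal_Form.Determinant"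
    "Jordan_Normal_Form.VS_Connect"
begin

text \<open>A frieze is a function \<open>e\<close> with \<open>e j i\<close> standing for $e_j(i)$: row \<open>j\<close>, position \<open>i\<close>.\<close>

definition frieze_rows :: "nat \<Rightarrow> nat \<Rightarrow> int set" where
  "frieze_rows k w = {- int k + 1 .. int (w + k + 1) - 1}"

definition diamond :: "(int \<Rightarrow> int \<Rightarrow> 'a) \<Rightarrow> nat \<Rightarrow> int \<Rightarrow> int \<Rightarrow> 'a mat" where
  "diamond e m j i = mat m m (\<lambda>(r, c). e (j + int c - int r) (i + int r))"

definition diamond_in_rows :: "int set \<Rightarrow> nat \<Rightarrow> int \<Rightarrow> bool" where
  "diamond_in_rows J m j \<longleftrightarrow> (\<forall>r<m. \<forall>c<m. j + int c - int r \<in> J)"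

text \<open>The extensional function space makes a family indexed by the rows correspond to
  exactly one function, so that the cardinality of the set counts friezes.\<close>

definition tame_friezes :: "nat \<Rightarrow> nat \<Rightarrow> (int \<Rightarrow> int \<Rightarrow> 'a::field) set" where
  "tame_friezes k w =
    {e \<in> frieze_rows k w \<rightarrow>\<^sub>E UNIV.
      (\<forall>i. \<forall>j \<in> {- int k + 1 .. -1}. e j i = 0) \<and>
      (\<forall>i. \<forall>j \<in> {int w + 2 .. int (w + k + 1) - 1}. e j i = 0) \<and>
      (\<forall>i. e 0 i = 1) \<and>
      (\<forall>i. e (int w + 1) i = 1) \<and>
      (\<forall>i j. diamond_in_rows (frieze_rows k w) k j \<longrightarrow> det (diamond e k j i) = 1) \<and>
      (\<forall>i j. diamond_in_rows (frieze_rows k w) (k + 1) j \<longrightarrow> det (diamond e (k + 1) j i) = 0)}"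

text \<open>\<open>proj_space k\<close> is the projective space of dimension \<open>k - 1\<close>; a point is the set of its
  homogeneous coordinate vectors.\<close>

definition proj_rel :: "nat \<Rightarrow> ('a::field vec \<times> 'a vec) set" where
  "proj_rel k = {(u, v). u \<in> carrier_vec k - {0\<^sub>v k} \<and> v \<in> carrier_vec k - {0\<^sub>v k} \<and>
                         (\<exists>c. c \<noteq> 0 \<and> v = c \<cdot>\<^sub>v u)}"

definition proj_space :: "nat \<Rightarrow> 'a::field vec set set" where
  "proj_space k = (carrier_vec k - {0\<^sub>v k}) // proj_rel k"

definition lin_indep_family :: "nat \<Rightarrow> nat \<Rightarrow> (nat \<Rightarrow> 'a::field vec) \<Rightarrow> bool" where
  "lin_indep_family k m V \<longleftrightarrow>
    inj_on V {..<m} \<and> \<not> module.lin_dep class_ring (module_vec TYPE('a) k) (V ` {..<m})"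

definition proj_indep :: "nat \<Rightarrow> nat \<Rightarrow> (nat \<Rightarrow> 'a::field vec set) \<Rightarrow> bool" where
  "proj_indep k m p \<longleftrightarrow> (\<exists>V. (\<forall>l<m. V l \<in> p l) \<and> lin_indep_family k m V)"

definition cyc :: "nat \<Rightarrow> nat \<Rightarrow> nat" where
  "cyc n i = (i - 1) mod n + 1"

definition Ck :: "nat \<Rightarrow> nat \<Rightarrow> (nat \<Rightarrow> 'a::field vec set) set" where
  "Ck k n = {v \<in> {1..n} \<rightarrow>\<^sub>E proj_space k.
              \<forall>i \<in> {1..n}. proj_indep k k (\<lambda>l. v (cyc n (i + l)))}"

definition is_lift :: "nat \<Rightarrow> (nat \<Rightarrow> 'a vec set) \<Rightarrow> (nat \<Rightarrow> 'a vec) \<Rightarrow> bool" where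
  "is_lift n v V \<longleftrightarrow> (\<forall>i \<in> {1..n}. V i \<in> v i)"

text \<open>Points are indexed modulo \<open>n\<close>. Their lifts are continued past \<open>n\<close> by the rule
  $V_{i+n} = (-1)^{k-1} V_i$, the quasi-periodicity of the vectors attached to a tame
  $\mathrm{SL}_k$-frieze. Equivalently, the window determinant is the Pluecker coordinate of the
  cyclic interval, with columns in increasing order of their indices in \<open>{1..n}\<close>. The sign is
  essential: with $V_{i+n} = V_i$ the count of friezes fails, e.g. for \<open>k = 2\<close>, \<open>w = 1\<close>
  over the field with 3 elements.\<close>

definition lift_ext :: "nat \<Rightarrow> nat \<Rightarrow> (nat \<Rightarrow> 'a::field vec) \<Rightarrow> nat \<Rightarrow> 'a vec" where
  "lift_ext k n V i = ((-1) ^ ((k - 1) * ((i - 1) div n))) \<cdot>\<^sub>v V (cyc n i)"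

definition window_det :: "nat \<Rightarrow> nat \<Rightarrow> (nat \<Rightarrow> 'a::field vec) \<Rightarrow> nat \<Rightarrow> 'a" where
  "window_det k n V i = det (mat_of_cols k (map (\<lambda>l. lift_ext k n V (i + l)) [0..<k]))"

definition Ck_star :: "nat \<Rightarrow> nat \<Rightarrow> (nat \<Rightarrow> 'a::field vec set) set" where
  "Ck_star k n = {v \<in> Ck k n. \<exists>V. is_lift n v V \<and>
     (let g = gcd k n in \<forall>i \<in> {1..g - 1}.
        (\<Prod>t<n div g. window_det k n V (i + t * g)) =
        (\<Prod>t<n div g. window_det k n V (i + 1 + t * g)))}"

definition PGL :: "'a::field itself \<Rightarrow> nat \<Rightarrow> 'a mat set monoid" where
  "PGL _ k = units_of (ring_mat TYPE('a) k ()) Mod {c \<cdot>\<^sub>m 1\<^sub>m k |c. c \<noteq> 0}"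

end

theory Submission
  imports Defs "Jordan_Normal_Form.DL_Rank" "HOL-Number_Theory.Cong"
begin

text \<open>A tame frieze is a matrix $M_{i,m} = e_{m-i}(i)$, and it factors as $M_{i,m} = \ell_i(V_m)$ for a
  sequence of vectors with $V_{m+n} = (-1)^{k-1} V_m$ and all window determinants equal to 1, where
  $\ell_i(x) = \det(V_{i-k+1}, \dots, V_{i-1}, x)$. The sequence is unique up to $\mathrm{SL}_k$, so
  friezes correspond to sequences whose first \<open>k\<close> vectors are the standard basis. Letting
  $\mathrm{GL}_k$ act on these yields freely all configurations with constant nonzero window
  determinants.

  Rescaling $V_i$ by $a_i$ multiplies the window determinant $d_i$ by $a_i \cdots a_{i+k-1}$. A
  configuration with determinants $d$ can be rescaled to constant ones iff the products of $d$ over the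
  residue classes modulo $g = \gcd(k,n)$ agree, and then in $(q-1)^g$ ways. Counting pairs of a scaling
  and a configuration gives $|\mathrm{GL}_k| \cdot |\mathrm{friezes}| = (q-1)^g |C_k^*(n)|$ for every
  $g$, and $C_k^*(n) = C_k(n)$ if $g = 1$.\<close>

section \<open>Determinants given by their columns\<close>

text \<open>Surjectivity is the delicate half, because nothing in the definition makes a frieze
  periodic in its position. The vectors \<open>frieze_col\<close> are therefore built from the
  positions 1, ..., k alone, which already contain the columns 1, ..., n of M in these rows. Their
  frieze agrees with the given one there, and tameness lets k consecutive positions determine all
  others, so no periodicity has to be proved beforehand.

  In the count, window determinants may have any constant nonzero value b. Then only the ratios of
  neighbouring products matter to a scaling, and exactly g parameters stay free; insisting on b = 1
  would bring in the question of which elements of K are (k/g)-th powers. The constant is absorbed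
  by passing from SL_k to GL_k. The scalars in GL_k use up one of the g factors q - 1, which leaves
  the exponent g - 1 over PGL.\<close>

definition col_det :: "nat \<Rightarrow> (nat \<Rightarrow> 'a::field vec) \<Rightarrow> 'a" where
  "col_det k X = det (mat k k (\<lambda>(r, c). X c $ r))"

lemma col_det_cong:
  assumes "\<And>c r. c < k \<Longrightarrow> r < k \<Longrightarrow> X c $ r = Y c $ r"
  shows "col_det k X = col_det k Y"
  unfolding col_det_def by (rule arg_cong[where f = det]) (auto simp: assms)

lemma col_det_mat_of_cols: "det (mat_of_cols k (map X [0..<k])) = col_det k X"
  unfolding col_det_def
  by (rule arg_cong[where f = det], rule eq_matI) (auto simp: mat_of_cols_def)

lemma col_det_smult:
  assumes "\<And>l. l < k \<Longrightarrow> X l \<in> carrier_vec k"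
  shows "col_det k (\<lambda>l. a l \<cdot>\<^sub>v X l) = (\<Prod>l<k. a l) * col_det k X"
proof -
  define M where "M = mat k k (\<lambda>(r, c). X c $ r)"
  define D where "D = mat k k (\<lambda>(r, c). if r = c then a c else 0)"
  have "mat k k (\<lambda>(r, c). (a c \<cdot>\<^sub>v X c) $ r) = M * D"
  proof (rule eq_matI)
    fix i j assume "i < dim_row (M * D)" "j < dim_col (M * D)"
    then have ij: "i < k" "j < k" by (auto simp: M_def D_def)
    have "(M * D) $$ (i, j) = (\<Sum>l\<in>{0..<k}. X l $ i * (if l = j then a j else 0))"
      using ij by (auto simp: M_def D_def scalar_prod_def)
    also have "\<dots> = (\<Sum>l\<in>{0..<k}. if l = j then X l $ i * a j else 0)"
      by (rule sum.cong) auto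
    also have "\<dots> = X j $ i * a j" using ij by (simp add: sum.delta)
    finally show "mat k k (\<lambda>(r, c). (a c \<cdot>\<^sub>v X c) $ r) $$ (i, j) = (M * D) $$ (i, j)"
      using ij assms[of j] by (simp add: mult.commute)
  qed (auto simp: M_def D_def)
  then have "col_det k (\<lambda>l. a l \<cdot>\<^sub>v X l) = det M * det D"
    unfolding col_det_def by (simp add: det_mult[of _ k] M_def D_def)
  also have "det D = prod_list (diag_mat D)"
    by (rule det_upper_triangular[of _ k]) (auto simp: D_def)
  also have "\<dots> = (\<Prod>l<k. a l)"
    unfolding prod_list_diag_prod D_def by (auto simp: atLeast0LessThan)
  finally show ?thesis by (simp add: M_def col_det_def mult.commute)
qed

lemma col_det_mult_mat_vec:
  assumes "A \<in> carrier_mat k k" "\<And>l. l < k \<Longrightarrow> X l \<in> carrier_vec k"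
  shows "col_det k (\<lambda>l. A *\<^sub>v X l) = det A * col_det k X"
proof -
  define M where "M = mat k k (\<lambda>(r, c). X c $ r)"
  have "mat k k (\<lambda>(r, c). (A *\<^sub>v X c) $ r) = A * M"
  proof (rule eq_matI)
    fix i j assume "i < dim_row (A * M)" "j < dim_col (A * M)"
    then have ij: "i < k" "j < k" using assms by (auto simp: M_def)
    have "col M j = X j" using ij assms(2)[of j] by (auto simp: M_def)
    then show "mat k k (\<lambda>(r, c). (A *\<^sub>v X c) $ r) $$ (i, j) = (A * M) $$ (i, j)"
      using ij assms(1) by (auto simp: M_def)
  qed (use assms in \<open>auto simp: M_def\<close>)
  then show ?thesis
    unfolding col_det_def using assms by (simp add: det_mult[of _ k] M_def)
qed

text \<open>Up to sign this is the generalised cross product of the first \<open>k - 1\<close>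
  vectors: the coefficients of the linear form that puts its argument into the last column.\<close>

definition last_form :: "nat \<Rightarrow> (nat \<Rightarrow> 'a::field vec) \<Rightarrow> nat \<Rightarrow> 'a" where
  "last_form k X r = cofactor (mat k k (\<lambda>(r, c). X c $ r)) r (k - 1)"

lemma last_form_cong:
  assumes "\<And>c r. c < k - 1 \<Longrightarrow> r < k \<Longrightarrow> X c $ r = Y c $ r" and "r < k"
  shows "last_form k X r = last_form k Y r"
  unfolding last_form_def cofactor_def mat_delete_def
  using assms by (auto intro!: arg_cong[where f = det])

lemma last_form_expand:
  assumes "k \<ge> 1"
  shows "(\<Sum>r<k. last_form k X r * y $ r) = col_det k (X(k - 1 := y))"
proof -
  have "col_det k (X(k - 1 := y)) =
      (\<Sum>r<k. y $ r * last_form k (X(k - 1 := y)) r)"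
    unfolding col_det_def last_form_def
    by (subst laplace_expansion_column[of _ k "k - 1"]) (use assms in auto)
  also have "\<dots> = (\<Sum>r<k. last_form k X r * y $ r)"
    by (intro sum.cong refl, subst last_form_cong[of k _ X]) auto
  finally show ?thesis by simp
qed

lemma last_form_expand_last:
  assumes "k \<ge> 1" "\<And>r. r < k \<Longrightarrow> y $ r = X (k - 1) $ r"
  shows "(\<Sum>r<k. last_form k X r * y $ r) = col_det k X"
  unfolding last_form_expand[OF assms(1)]
  by (rule col_det_cong) (use assms in auto)

lemma last_form_expand_other:
  assumes "c < k - 1" "\<And>r. r < k \<Longrightarrow> y $ r = X c $ r"
  shows "(\<Sum>r<k. last_form k X r * y $ r) = 0"
proof -
  have "k \<ge> 1" using assms by auto
  show ?thesis unfolding last_form_expand[OF \<open>k \<ge> 1\<close>] col_det_def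
    by (rule det_identical_columns[of _ k c "k - 1"]) (use assms in auto)
qed

text \<open>Expanding along the first column and along the last column uses the same minors, up to
  the sign $(-1)^{k-1}$.\<close>

lemma last_form_expand_first:
  assumes "k \<ge> 1" "\<And>c r. c < k - 1 \<Longrightarrow> r < k \<Longrightarrow> X c $ r = Y (Suc c) $ r"
  shows "(\<Sum>r<k. last_form k X r * Y 0 $ r) = (-1) ^ (k - 1) * col_det k Y"
proof -
  have "col_det k Y = (\<Sum>r<k. Y 0 $ r * cofactor (mat k k (\<lambda>(r, c). Y c $ r)) r 0)"
    unfolding col_det_def
    by (subst laplace_expansion_column[of _ k 0]) (use assms in auto)
  moreover have "cofactor (mat k k (\<lambda>(r, c). Y c $ r)) r 0 = (-1) ^ (k - 1) * last_form k X r"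
    if "r < k" for r
  proof -
    have "mat_delete (mat k k (\<lambda>(r, c). Y c $ r)) r 0 =
        mat_delete (mat k k (\<lambda>(r, c). X c $ r)) r (k - 1)"
      unfolding mat_delete_def by (rule eq_matI) (use assms(2) in auto)
    moreover have "((-1) ^ r :: 'a) = (-1) ^ (k - 1) * (-1) ^ (r + (k - 1))"
      by (simp add: power_add)
    ultimately show ?thesis unfolding last_form_def cofactor_def by simp
  qed
  ultimately have "col_det k Y = (\<Sum>r<k. Y 0 $ r * ((-1) ^ (k - 1) * last_form k X r))"
    by simp
  also have "\<dots> = (-1) ^ (k - 1) * (\<Sum>r<k. last_form k X r * Y 0 $ r)"
    by (simp add: sum_distrib_left algebra_simps)
  finally show ?thesis by simp
qed

text \<open>Moving the first column to the end passes \<open>k - 1\<close> others and costs the sign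
  \<open>(-1) ^ (k - 1)\<close>, which is precisely the factor between \<open>X (t + k)\<close> and
  \<open>X t\<close>.\<close>

lemma col_det_rotate:
  assumes "k \<ge> 1" and "\<And>i. i < k \<Longrightarrow> X i \<in> carrier_vec k"
    and X: "\<And>i. i < k \<Longrightarrow> X (i + k) = (-1) ^ (k - 1) \<cdot>\<^sub>v X i" and "t \<le> k"
  shows "col_det k (\<lambda>c. X (t + c)) = col_det k X"
  using \<open>t \<le> k\<close>
proof (induction t)
  case (Suc t)
  have dim: "dim_vec (X t) = k" using assms(2)[of t] Suc.prems by auto
  have "col_det k (\<lambda>c. X (Suc t + c)) =
      (\<Sum>r<k. last_form k (\<lambda>c. X (Suc t + c)) r * X (t + k) $ r)"
    by (rule last_form_expand_last[symmetric]) (use assms in auto)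
  also have "\<dots> = (-1) ^ (k - 1) * (\<Sum>r<k. last_form k (\<lambda>c. X (Suc t + c)) r * X (t + 0) $ r)"
    using Suc.prems dim X[of t] by (simp add: sum_distrib_left mult.assoc mult.left_commute)
  also have "\<dots> = (-1) ^ (k - 1) * ((-1) ^ (k - 1) * col_det k (\<lambda>c. X (t + c)))"
    by (subst last_form_expand_first[where Y = "\<lambda>c. X (t + c)"]) (use assms in auto)
  also have "\<dots> = col_det k (\<lambda>c. X (t + c))" by simp
  finally show ?case using Suc by simp
qed simp

text \<open>The columns form a basis, and a linear form, here with coefficients \<open>x\<close> or
  \<open>y\<close>, is determined by its values on a basis.\<close>

lemma col_det_cancel:
  assumes "col_det k X \<noteq> 0"
    and "\<And>c. c < k \<Longrightarrow> (\<Sum>r<k. x r * X c $ r) = (\<Sum>r<k. y r * X c $ r)" and "r < k"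
  shows "x r = y r"
proof -
  define M where "M = mat k k (\<lambda>(r, c). X c $ r)"
  define v where "v = vec k (\<lambda>r. x r - y r)"
  have M: "M\<^sup>T \<in> carrier_mat k k" by (simp add: M_def)
  have "det M\<^sup>T \<noteq> 0" using assms(1) by (simp add: det_transpose[of _ k] M_def col_det_def)
  moreover have "M\<^sup>T *\<^sub>v v = 0\<^sub>v k"
  proof (rule eq_vecI)
    fix c assume "c < dim_vec (0\<^sub>v k)"
    then have c: "c < k" by simp
    have "(M\<^sup>T *\<^sub>v v) $ c = (\<Sum>r<k. X c $ r * (x r - y r))"
      using c by (simp add: M_def v_def scalar_prod_def atLeast0LessThan)
    also have "\<dots> = (\<Sum>r<k. x r * X c $ r) - (\<Sum>r<k. y r * X c $ r)"
      by (simp add: algebra_simps sum_subtractf)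
    finally show "(M\<^sup>T *\<^sub>v v) $ c = 0\<^sub>v k $ c" using assms(2)[OF c] c by simp
  qed (simp add: M_def)
  moreover have "v \<in> carrier_vec k" by (simp add: v_def)
  ultimately have "v = 0\<^sub>v k"
    using det_0_iff_vec_prod_zero_field[OF M] by blast
  then have "v $ r = 0" using \<open>r < k\<close> by simp
  then show ?thesis using \<open>r < k\<close> by (simp add: v_def)
qed

lemma lin_indep_family_iff_col_det:
  fixes X :: "nat \<Rightarrow> 'a::field vec"
  assumes X: "\<And>l. l < k \<Longrightarrow> X l \<in> carrier_vec k"
  shows "lin_indep_family k k X \<longleftrightarrow> col_det k X \<noteq> 0"
proof -
  interpret vec_space "TYPE('a)" k .
  define A where "A = mat_of_cols k (map X [0..<k])"
  have A: "A \<in> carrier_mat k k" by (auto simp: A_def mat_of_cols_def)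
  have cols: "cols A = map X [0..<k]" unfolding A_def
    by (rule cols_mat_of_cols) (use X in auto)
  \<comment> \<open>The injectivity conjunct of \<open>lin_indep_family\<close> excludes repeated
    columns, which the mere set of columns would hide.\<close>
  have "distinct (cols A) \<longleftrightarrow> inj_on X {..<k}"
    by (simp add: cols distinct_map atLeast0LessThan)
  moreover have "set (cols A) = X ` {..<k}" by (simp add: cols atLeast0LessThan)
  moreover have "det A \<noteq> 0 \<longleftrightarrow> distinct (cols A) \<and> lin_indpt (set (cols A))"
    using det_rank_iff[OF A] lin_indpt_full_rank[OF A] full_rank_lin_indpt[OF A]
      non_distinct_low_rank[OF A] by (cases "distinct (cols A)") auto
  moreover have "det A = col_det k X" unfolding A_def by (rule col_det_mat_of_cols)
  ultimately show ?thesis unfolding lin_indep_family_def by simp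
qed

section \<open>Friezes from sequences of vectors\<close>

text \<open>\<open>seq_form k U i\<close> is the coefficient vector of the form $\ell_i$, and \<open>seq_entry k U i m\<close> is
  $M_{i,m} = \ell_i(V_m)$.\<close>

definition seq_form :: "nat \<Rightarrow> (int \<Rightarrow> 'a::field vec) \<Rightarrow> int \<Rightarrow> nat \<Rightarrow> 'a" where
  "seq_form k U i r = last_form k (\<lambda>c. U (i - int k + 1 + int c)) r"

definition seq_entry :: "nat \<Rightarrow> (int \<Rightarrow> 'a::field vec) \<Rightarrow> int \<Rightarrow> int \<Rightarrow> 'a" where
  "seq_entry k U i m = (\<Sum>r<k. seq_form k U i r * U m $ r)"

text \<open>Row \<open>j\<close>, position \<open>i\<close> of the frieze is the entry of M in row
  \<open>i\<close>, column \<open>i + j\<close>. The value \<open>undefined\<close> makes the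
  function extensional, as \<open>tame_friezes\<close> demands.\<close>

definition seq_frieze :: "nat \<Rightarrow> nat \<Rightarrow> (int \<Rightarrow> 'a::field vec) \<Rightarrow> int \<Rightarrow> int \<Rightarrow> 'a" where
  "seq_frieze k w U = (\<lambda>j. if j \<in> frieze_rows k w then (\<lambda>i. seq_entry k U i (i + j)) else undefined)"

lemma det_eq_1_of_triangular:
  fixes A :: "'a::field mat"
  assumes "A \<in> carrier_mat m m" "\<And>r. r < m \<Longrightarrow> A $$ (r, r) = 1"
    and "(\<forall>r<m. \<forall>c<r. A $$ (r, c) = 0) \<or> (\<forall>c<m. \<forall>r<c. A $$ (r, c) = 0)"
  shows "det A = 1"
proof -
  have "det A = prod_list (diag_mat A)"
    using assms(3)
  proof
    assume "\<forall>r<m. \<forall>c<r. A $$ (r, c) = 0"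
    then show ?thesis using assms(1) by (intro det_upper_triangular[of _ m]) auto
  next
    assume "\<forall>c<m. \<forall>r<c. A $$ (r, c) = 0"
    then show ?thesis using assms(1) by (intro det_lower_triangular[of m]) auto
  qed
  also have "\<dots> = 1" using assms by (auto simp: prod_list_diag_prod)
  finally show ?thesis .
qed

locale unimodular_seq =
  fixes k w n :: nat and U :: "int \<Rightarrow> 'a::field vec"
  assumes k: "k \<ge> 1" and n: "n = w + k + 1"
    and carrier: "U i \<in> carrier_vec k"
    and shift: "U (i + int n) = (-1) ^ (k - 1) \<cdot>\<^sub>v U i"
    and window: "col_det k (\<lambda>c. U (i + int c)) = 1"
begin

lemma seq_entry_shift: "seq_entry k U i (m + int n) = (-1) ^ (k - 1) * seq_entry k U i m"
  using carrier[of m] unfolding seq_entry_def shift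
  by (simp add: sum_distrib_left mult.left_commute)

text \<open>For these indices \<open>U m\<close> is one of the \<open>k - 1\<close> vectors defining
  the form at \<open>i\<close>, so a column is repeated. This gives the zero rows below row
  0.\<close>

lemma seq_entry_0:
  assumes "i - int k < m" "m < i"
  shows "seq_entry k U i m = 0"
proof -
  define c where "c = nat (m - (i - int k + 1))"
  have c: "m = i - int k + 1 + int c" "c < k - 1" using assms by (auto simp: c_def)
  show ?thesis unfolding seq_entry_def seq_form_def
    by (rule last_form_expand_other[of c]) (use c in auto)
qed

lemma seq_entry_diag: "seq_entry k U i i = 1"
proof -
  have "seq_entry k U i i = col_det k (\<lambda>c. U (i - int k + 1 + int c))"
    unfolding seq_entry_def seq_form_def
    by (rule last_form_expand_last) (use k in \<open>auto simp: of_nat_diff\<close>)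
  then show ?thesis using window[of "i - int k + 1"] by simp
qed

text \<open>Here the sign of the quasi-period is forced: the form at \<open>i\<close> takes the
  value \<open>(-1) ^ (k - 1)\<close> on \<open>U (i - k)\<close> by rotation of columns, and the
  shift by \<open>n\<close> leads to row \<open>w + 1\<close> and must cancel it.\<close>

lemma seq_entry_last: "seq_entry k U i (i + int w + 1) = 1"
proof -
  have "seq_entry k U i (i - int k) = (-1) ^ (k - 1) * col_det k (\<lambda>c. U (i - int k + int c))"
    unfolding seq_entry_def seq_form_def
    using last_form_expand_first[OF k, of "\<lambda>c. U (i - int k + 1 + int c)" "\<lambda>c. U (i - int k + int c)"]
    by (simp add: algebra_simps)
  then have "seq_entry k U i (i - int k) = (-1) ^ (k - 1)" by (simp add: window)
  then have "seq_entry k U i ((i - int k) + int n) = 1" by (simp add: seq_entry_shift)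
  then show ?thesis by (simp add: n algebra_simps)
qed

lemma seq_entry_0':
  assumes "i + int w + 1 < m" "m < i + int n"
  shows "seq_entry k U i m = 0"
  using seq_entry_shift[of i "m - int n"] seq_entry_0[of i "m - int n"] assms n by simp

lemma seq_entry_prod:
  "mat k k (\<lambda>(r, c). seq_entry k U (i + int r) (m + int c)) =
    mat k k (\<lambda>(r, c). seq_form k U (i + int r) c) * mat k k (\<lambda>(r, c). U (m + int c) $ r)"
  by (rule eq_matI) (auto simp: seq_entry_def scalar_prod_def atLeast0LessThan)

text \<open>The entries with columns starting at \<open>i\<close> too form an upper triangular
  matrix with unit diagonal. It is the product of this matrix of forms with a window of determinant
  1.\<close>

lemma det_seq_form: "det (mat k k (\<lambda>(r, c). seq_form k U (i + int r) c)) = 1"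
proof -
  have "det (mat k k (\<lambda>(r, c). seq_entry k U (i + int r) (i + int c))) = 1"
  proof (rule det_eq_1_of_triangular[of _ k])
    show "(\<forall>r<k. \<forall>c<r. mat k k (\<lambda>(r, c). seq_entry k U (i + int r) (i + int c)) $$ (r, c) = 0) \<or>
        (\<forall>c<k. \<forall>r<c. mat k k (\<lambda>(r, c). seq_entry k U (i + int r) (i + int c)) $$ (r, c) = 0)"
      by (intro disjI1) (auto intro!: seq_entry_0)
  qed (auto simp: seq_entry_diag)
  then show ?thesis
    unfolding seq_entry_prod using window[of i] by (simp add: det_mult[of _ k] col_det_def)
qed

lemma det_seq_entry: "det (mat k k (\<lambda>(r, c). seq_entry k U (i + int r) (m + int c))) = 1"
  unfolding seq_entry_prod using window[of m] det_seq_form[of i]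
  by (simp add: det_mult[of _ k] col_det_def)

text \<open>The matrix factors through a space of dimension \<open>k\<close>. Padding both factors
  with zeros to square matrices makes the determinant vanish.\<close>

lemma det_seq_entry_Suc:
  "det (mat (Suc k) (Suc k) (\<lambda>(r, c). seq_entry k U (i + int r) (m + int c))) = 0"
proof -
  define A where
    "A = mat (Suc k) (Suc k) (\<lambda>(r, c). if c < k then seq_form k U (i + int r) c else 0)"
  define B where
    "B = mat (Suc k) (Suc k) (\<lambda>(r, c). if r < k then U (m + int c) $ r else 0)"
  have "mat (Suc k) (Suc k) (\<lambda>(r, c). seq_entry k U (i + int r) (m + int c)) = A * B"
    by (rule eq_matI)
      (auto simp: A_def B_def seq_entry_def scalar_prod_def atLeast0LessThan lessThan_Suc)
  moreover have "det B = 0"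
    by (subst laplace_expansion_row[of _ "Suc k" k]) (auto simp: B_def)
  ultimately show ?thesis by (simp add: det_mult[of _ "Suc k"] A_def B_def)
qed

lemma seq_frieze_tame: "seq_frieze k w U \<in> tame_friezes k w"
proof -
  \<comment> \<open>Along a diamond the row of M depends on \<open>r\<close> only and its column on
    \<open>c\<close> only, so diamonds are contiguous square blocks of M.\<close>
  have D: "diamond (seq_frieze k w U) m j i =
      mat m m (\<lambda>(r, c). seq_entry k U (i + int r) ((i + j) + int c))"
    if "diamond_in_rows (frieze_rows k w) m j" for m j i
    using that unfolding diamond_def diamond_in_rows_def seq_frieze_def
    by (intro eq_matI) (auto simp: algebra_simps)
  have R: "seq_frieze k w U j i = seq_entry k U i (i + j)" if "- int k < j" "j < int n" for j i
    using that n by (auto simp: seq_frieze_def frieze_rows_def)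
  show ?thesis
    unfolding tame_friezes_def
  proof (intro CollectI conjI allI ballI impI)
    show "seq_frieze k w U \<in> frieze_rows k w \<rightarrow>\<^sub>E UNIV"
      by (auto simp: seq_frieze_def)
  next
    fix i j assume "j \<in> {- int k + 1..- 1}"
    then show "seq_frieze k w U j i = 0"
      using n by (subst R) (auto intro!: seq_entry_0)
  next
    fix i j assume "j \<in> {int w + 2..int (w + k + 1) - 1}"
    then show "seq_frieze k w U j i = 0"
      using n by (subst R) (auto intro!: seq_entry_0')
  next
    fix i show "seq_frieze k w U 0 i = 1"
      using n k by (subst R) (auto simp: seq_entry_diag)
  next
    fix i show "seq_frieze k w U (int w + 1) i = 1"
      using n k seq_entry_last[of i] by (subst R) (auto simp: algebra_simps)
  next
    fix i j assume "diamond_in_rows (frieze_rows k w) k j"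
    then show "det (diamond (seq_frieze k w U) k j i) = 1"
      by (simp add: D det_seq_entry)
  next
    fix i j assume "diamond_in_rows (frieze_rows k w) (k + 1) j"
    then show "det (diamond (seq_frieze k w U) (k + 1) j i) = 0"
      by (simp add: D det_seq_entry_Suc)
  qed
qed

end

section \<open>Rigidity: k consecutive positions determine a tame frieze\<close>

lemma det_eq_imp_entry_eq:
  fixes A B :: "'a::field mat"
  assumes A: "A \<in> carrier_mat m m" and B: "B \<in> carrier_mat m m" and p: "p < m"
    and eq: "\<And>r c. r < m \<Longrightarrow> c < m \<Longrightarrow> (r, c) \<noteq> (p, p) \<Longrightarrow> A $$ (r, c) = B $$ (r, c)"
    and del: "det (mat_delete A p p) = 1" and det: "det A = det B"
  shows "A $$ (p, p) = B $$ (p, p)"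
proof -
  have cof: "cofactor A p c = cofactor B p c" if "c < m" for c
  proof -
    have "mat_delete A p c = mat_delete B p c"
      using A B that p unfolding mat_delete_def by (intro eq_matI) (auto intro!: eq)
    then show ?thesis by (simp add: cofactor_def)
  qed
  \<comment> \<open>Expanded along row \<open>p\<close>, the determinant is affine in the entry
    \<open>(p, p)\<close>, and the slope is its cofactor, which is 1.\<close>
  have "0 = (\<Sum>c<m. A $$ (p, c) * cofactor A p c) - (\<Sum>c<m. B $$ (p, c) * cofactor A p c)"
    using laplace_expansion_row[OF A p] laplace_expansion_row[OF B p] det cof by simp
  also have "\<dots> = (\<Sum>c<m. (A $$ (p, c) - B $$ (p, c)) * cofactor A p c)"
    by (simp add: sum_subtractf algebra_simps)
  also have "\<dots> = (\<Sum>c<m. if c = p then (A $$ (p, p) - B $$ (p, p)) * cofactor A p p else 0)"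
    by (rule sum.cong) (use p eq in auto)
  also have "\<dots> = (A $$ (p, p) - B $$ (p, p)) * cofactor A p p"
    using p by (simp add: sum.delta)
  also have "cofactor A p p = 1" using del by (simp add: cofactor_def flip: power_add mult_2)
  finally show ?thesis by simp
qed

lemma diamond_carrier: "diamond e m j i \<in> carrier_mat m m"
  by (simp add: diamond_def)

lemma mat_delete_diamond_last: "mat_delete (diamond e (Suc k) j i) k k = diamond e k j i"
  unfolding mat_delete_def diamond_def by (rule eq_matI) auto

lemma mat_delete_diamond_first: "mat_delete (diamond e (Suc k) j i) 0 0 = diamond e k j (i + 1)"
  unfolding mat_delete_def diamond_def by (rule eq_matI) (auto simp: algebra_simps)

context
  fixes k w :: nat and e :: "int \<Rightarrow> int \<Rightarrow> 'a::field"
  assumes e: "e \<in> tame_friezes k w"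
begin

lemma frieze_0: "- int k < j \<Longrightarrow> j < 0 \<Longrightarrow> e j i = 0"
  using e by (auto simp: tame_friezes_def)

lemma frieze_0': "int w + 1 < j \<Longrightarrow> j \<le> int (w + k) \<Longrightarrow> e j i = 0"
  using e by (auto simp: tame_friezes_def)

lemma frieze_1: "e 0 i = 1" "e (int w + 1) i = 1"
  using e by (auto simp: tame_friezes_def)

lemma frieze_undefined: "j \<notin> frieze_rows k w \<Longrightarrow> e j = undefined"
  using e by (auto simp: tame_friezes_def PiE_def extensional_def)

text \<open>Row indices in the diamond run from \<open>j - (k - 1)\<close> to
  \<open>j + (k - 1)\<close>, and the frieze rows from \<open>- k + 1\<close> to
  \<open>w + k\<close>; hence the bounds on \<open>j\<close>. For size \<open>k + 1\<close> the
  range of \<open>j\<close> shrinks by one at both ends.\<close>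

lemma frieze_diamond: "0 \<le> j \<Longrightarrow> j \<le> int w + 1 \<Longrightarrow> det (diamond e k j i) = 1"
proof -
  assume "0 \<le> j" "j \<le> int w + 1"
  then have "diamond_in_rows (frieze_rows k w) k j"
    by (auto simp: diamond_in_rows_def frieze_rows_def)
  then show ?thesis using e by (auto simp: tame_friezes_def)
qed

lemma frieze_diamond_Suc: "1 \<le> j \<Longrightarrow> j \<le> int w \<Longrightarrow> det (diamond e (Suc k) j i) = 0"
proof -
  assume "1 \<le> j" "j \<le> int w"
  then have "diamond_in_rows (frieze_rows k w) (k + 1) j"
    by (auto simp: diamond_in_rows_def frieze_rows_def)
  then show ?thesis using e by (auto simp: tame_friezes_def)
qed

end

lemma friezes_agree_trivial_rows:
  assumes "e \<in> tame_friezes k w" "e' \<in> tame_friezes k w"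
    and "j \<le> 0 \<or> int w < j"
  shows "e j i = e' j i"
proof (cases "j \<in> frieze_rows k w")
  case True
  then have "- int k < j" "j \<le> int (w + k)" by (auto simp: frieze_rows_def)
  moreover have "j < 0 \<or> j = 0 \<or> j = int w + 1 \<or> int w + 1 < j" using assms(3) by auto
  ultimately show ?thesis
    using assms(1,2) by (auto simp: frieze_0 frieze_0' frieze_1)
qed (simp add: frieze_undefined[OF assms(1)] frieze_undefined[OF assms(2)])

text \<open>A $(k+1)$-diamond has determinant 0 while the minors complementary to two opposite corners are
  1, so either corner entry is determined by the other entries. Hence \<open>k\<close> consecutive positions
  determine the next position in both directions.\<close>

lemma friezes_agree_up:
  assumes e: "e \<in> tame_friezes k w" "e' \<in> tame_friezes k w"
    and agree: "\<And>j r. r < k \<Longrightarrow> e j (i + int r) = e' j (i + int r)"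
  shows "e j (i + int k) = e' j (i + int k)"
proof -
  \<comment> \<open>The unknown entry is the corner \<open>(k, k)\<close>. The rest of its matrix
    row lies at the same position in rows below \<open>j\<close>, so the induction climbs from row
    0.\<close>
  have *: "e j (i + int k) = e' j (i + int k)" if "j \<le> int t" for t j
    using that
  proof (induction t arbitrary: j)
    case 0
    then show ?case using friezes_agree_trivial_rows[OF e] by auto
  next
    case (Suc t)
    show ?case
    proof (cases "j = int (Suc t) \<and> j \<le> int w")
      case True
      then have j: "1 \<le> j" "j \<le> int w" by auto
      have "diamond e (Suc k) j i $$ (k, k) = diamond e' (Suc k) j i $$ (k, k)"
      proof (rule det_eq_imp_entry_eq[of _ "Suc k"])
        fix r c assume rc: "r < Suc k" "c < Suc k" "(r, c) \<noteq> (k, k)"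
        show "diamond e (Suc k) j i $$ (r, c) = diamond e' (Suc k) j i $$ (r, c)"
        proof (cases "r < k")
          case True then show ?thesis using rc by (simp add: diamond_def agree)
        next
          case False
          then have "r = k" "c < k" using rc by auto
          then show ?thesis using Suc.IH[of "j + int c - int k"] True
            by (simp add: diamond_def)
        qed
      qed (use j e in \<open>auto simp: mat_delete_diamond_last frieze_diamond frieze_diamond_Suc diamond_carrier\<close>)
      then show ?thesis by (simp add: diamond_def)
    next
      case False
      then show ?thesis using Suc friezes_agree_trivial_rows[OF e, of j]
        by (cases "j \<le> int t") auto
    qed
  qed
  show ?thesis using *[of j "nat j"] by simp
qed

lemma friezes_agree_down:
  assumes e: "e \<in> tame_friezes k w" "e' \<in> tame_friezes k w"
    and agree: "\<And>j r. r < k \<Longrightarrow> e j (i + 1 + int r) = e' j (i + 1 + int r)"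
  shows "e j i = e' j i"
proof -
  \<comment> \<open>Mirror image: the unknown entry is the corner \<open>(0, 0)\<close>, and the
    rest of its matrix row lies at the same position in rows above \<open>j\<close>, so the
    induction descends from row \<open>w + 1\<close>.\<close>
  have *: "e j i = e' j i" if "j > int w - int t" for t j
    using that
  proof (induction t arbitrary: j)
    case 0
    then show ?case using friezes_agree_trivial_rows[OF e] by auto
  next
    case (Suc t)
    show ?case
    proof (cases "j = int w - int t \<and> 1 \<le> j")
      case True
      then have j: "1 \<le> j" "j \<le> int w" by auto
      have "diamond e (Suc k) j i $$ (0, 0) = diamond e' (Suc k) j i $$ (0, 0)"
      proof (rule det_eq_imp_entry_eq[of _ "Suc k"])
        fix r c assume rc: "r < Suc k" "c < Suc k" "(r, c) \<noteq> (0, 0)"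
        show "diamond e (Suc k) j i $$ (r, c) = diamond e' (Suc k) j i $$ (r, c)"
        proof (cases "r = 0")
          case False then show ?thesis using rc agree[of "r - 1"]
            by (simp add: diamond_def of_nat_diff)
        next
          case r: True
          then have "c > 0" using rc by auto
          then show ?thesis using Suc.IH[of "j + int c"] True r rc
            by (simp add: diamond_def)
        qed
      qed (use j e in \<open>auto simp: mat_delete_diamond_first frieze_diamond frieze_diamond_Suc diamond_carrier\<close>)
      then show ?thesis by (simp add: diamond_def)
    next
      case False
      then show ?thesis using Suc friezes_agree_trivial_rows[OF e, of j]
        by (cases "j > int w - int t") auto
    qed
  qed
  show ?thesis using *[of "nat (int w - j + 1)" j] by (cases "j \<le> int w")
      (auto simp: friezes_agree_trivial_rows[OF e])
qed

lemma frieze_eqI: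
  assumes e: "e \<in> tame_friezes k w" "e' \<in> tame_friezes k w"
    and agree: "\<And>j r. r < k \<Longrightarrow> 1 \<le> j \<Longrightarrow> j \<le> int w \<Longrightarrow> e j (1 + int r) = e' j (1 + int r)"
  shows "e = e'"
proof -
  \<comment> \<open>The window of \<open>k\<close> positions slides by one to either side; only the
    position that enters it is new.\<close>
  have all: "\<forall>j r. r < k \<longrightarrow> e j (i + int r) = e' j (i + int r)" for i
  proof (induction i rule: int_induct[where k = 1])
    case base
    show ?case
    proof (intro allI impI)
      fix j r assume "r < k"
      then show "e j (1 + int r) = e' j (1 + int r)"
        using agree friezes_agree_trivial_rows[OF e] by (cases "1 \<le> j \<and> j \<le> int w") auto
    qed
  next
    case (step1 i)
    show ?case
    proof (intro allI impI)
      fix j r assume r: "r < k"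
      show "e j (i + 1 + int r) = e' j (i + 1 + int r)"
      proof (cases "Suc r < k")
        case True
        then show ?thesis using step1(2)[rule_format, of "Suc r" j] by (simp add: algebra_simps)
      next
        case False
        then have "k = Suc r" using r by auto
        then show ?thesis using friezes_agree_up[OF e, of i j] step1(2) by (simp add: algebra_simps)
      qed
    qed
  next
    case (step2 i)
    show ?case
    proof (intro allI impI)
      fix j r assume r: "r < k"
      show "e j (i - 1 + int r) = e' j (i - 1 + int r)"
      proof (cases r)
        case 0
        then show ?thesis using friezes_agree_down[OF e, of "i - 1" j] step2(2) by simp
      next
        case (Suc s)
        then show ?thesis using step2(2)[rule_format, of s j] r by (simp add: algebra_simps)
      qed
    qed
  qed
  show ?thesis
  proof (cases "k = 0")
    case False
    show ?thesis
    proof (intro ext)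
      fix j i show "e j i = e' j i" using all[of i, rule_format, of 0 j] False by simp
    qed
  next
    case True
    show ?thesis using friezes_agree_up[OF e] True by (intro ext) fastforce
  qed
qed

section \<open>Normalised configurations\<close>

text \<open>The continuation rule of \<open>lift_ext\<close>, carried to all integers because the
  form at \<open>i\<close> uses vectors from index \<open>i - k + 1\<close> on. For negative
  quotients the sign needs an integer exponent.\<close>

definition qext :: "nat \<Rightarrow> nat \<Rightarrow> (nat \<Rightarrow> 'a::field vec) \<Rightarrow> int \<Rightarrow> 'a vec" where
  "qext k n V i = ((-1) ^ (k - 1)) powi ((i - 1) div int n) \<cdot>\<^sub>v V (nat ((i - 1) mod int n) + 1)"

lemma qext_index: "n > 0 \<Longrightarrow> nat ((i - 1) mod int n) + 1 \<in> {1..n}"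
  using pos_mod_bound[of "int n" "i - 1"] pos_mod_sign[of "int n" "i - 1"]
  by (simp add: nat_less_iff Suc_le_eq)

lemma qext_base:
  assumes "i \<in> {1..n}"
  shows "qext k n V (int i) = V i"
proof -
  have "(int i - 1) div int n = 0" "(int i - 1) mod int n = int i - 1" using assms by auto
  then show ?thesis using assms by (auto simp: qext_def nat_diff_distrib')
qed

lemma qext_base_int: "1 \<le> i \<Longrightarrow> i \<le> int n \<Longrightarrow> qext k n V i = V (nat i)"
  using qext_base[of "nat i" n k V] by (simp add: nat_le_iff Suc_le_eq)

lemma qext_shift:
  assumes "n > 0"
  shows "qext k n V (i + int n) = (-1) ^ (k - 1) \<cdot>\<^sub>v qext k n V i"
proof -
  have "i + int n - 1 = (i - 1) + int n" by simp
  then have "(i + int n - 1) div int n = (i - 1) div int n + 1"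
      "(i + int n - 1) mod int n = (i - 1) mod int n"
    using assms by (simp_all only: div_add_self2 mod_add_self2 of_nat_eq_0_iff)
  then show ?thesis
    by (simp add: qext_def smult_smult_assoc power_int_add mult.commute)
qed

lemma qext_carrier:
  assumes "n > 0" "\<And>i. i \<in> {1..n} \<Longrightarrow> V i \<in> carrier_vec k"
  shows "qext k n V i \<in> carrier_vec k"
  unfolding qext_def using assms(2)[OF qext_index[OF assms(1)]] by simp

lemma qext_mult_mat_vec:
  assumes "n > 0" "A \<in> carrier_mat k k" "\<And>i. i \<in> {1..n} \<Longrightarrow> V i \<in> carrier_vec k"
  shows "qext k n (\<lambda>i\<in>{1..n}. A *\<^sub>v V i) i = A *\<^sub>v qext k n V i"
  unfolding qext_def
  using qext_index[OF assms(1), of i] assms(3)[OF qext_index[OF assms(1)]] assms(2)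
  by (simp add: mult_mat_vec[of A k k])

lemma lift_ext_eq_qext:
  assumes "i \<ge> 1"
  shows "lift_ext k n V i = qext k n V (int i)"
proof -
  obtain p where "i = Suc p" using assms by (cases i) auto
  then show ?thesis
    by (simp add: lift_ext_def qext_def cyc_def power_mult flip: zdiv_int zmod_int)
qed

lemma window_det_eq_col_det:
  assumes "i \<ge> 1"
  shows "window_det k n V i = col_det k (\<lambda>c. qext k n V (int i + int c))"
  unfolding window_det_def col_det_mat_of_cols
  using assms by (simp add: lift_ext_eq_qext)

lemma window_det_mult_mat_vec:
  assumes "n > 0" "A \<in> carrier_mat k k" "\<And>i. i \<in> {1..n} \<Longrightarrow> V i \<in> carrier_vec k" "i \<ge> 1"
  shows "window_det k n (\<lambda>i\<in>{1..n}. A *\<^sub>v V i) i = det A * window_det k n V i"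
  unfolding window_det_eq_col_det[OF \<open>i \<ge> 1\<close>]
  by (subst qext_mult_mat_vec) (use assms in \<open>auto intro!: col_det_mult_mat_vec qext_carrier\<close>)

text \<open>Each of the \<open>k\<close> columns contributes a sign, and \<open>k * (k - 1)\<close>
  is even. Thus the conditions on the \<open>n\<close> windows starting in \<open>{1..n}\<close>
  cover all windows.\<close>

lemma col_det_qext_shift:
  assumes "n > 0" "\<And>i. i \<in> {1..n} \<Longrightarrow> V i \<in> carrier_vec k"
  shows "col_det k (\<lambda>c. qext k n V (i + int n + int c)) = col_det k (\<lambda>c. qext k n V (i + int c))"
proof -
  have "col_det k (\<lambda>c. qext k n V (i + int n + int c)) =
      col_det k (\<lambda>c. (-1) ^ (k - 1) \<cdot>\<^sub>v qext k n V (i + int c))"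
    by (simp only: qext_shift[OF assms(1), symmetric] ac_simps)
  also have "\<dots> = ((-1) ^ (k - 1)) ^ k * col_det k (\<lambda>c. qext k n V (i + int c))"
    by (subst col_det_smult) (use assms in \<open>auto intro!: qext_carrier\<close>)
  also have "((-1) ^ (k - 1)) ^ k = (1 :: 'a)"
    unfolding power_mult[symmetric] by (rule neg_one_even_power) (cases k; auto)
  finally show ?thesis by simp
qed

lemma int_periodic_cases:
  fixes f :: "int \<Rightarrow> 'b"
  assumes "n > 0" and per: "\<And>i. f (i + int n) = f i"
  shows "\<exists>j\<in>{1..n}. f i = f (int j)"
proof -
  have *: "f (j + int n * t) = f j" for j t
  proof (induction t rule: int_induct[where k = 0])
    case (step1 t)
    then show ?case using per[of "j + int n * t"] by (simp add: algebra_simps)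
  next
    case (step2 t)
    then show ?case using per[of "j + int n * (t - 1)"] by (simp add: algebra_simps)
  qed simp
  have "i = int (nat ((i - 1) mod int n) + 1) + int n * ((i - 1) div int n)"
    using assms(1) by (simp add: algebra_simps)
  then have "f i = f (int (nat ((i - 1) mod int n) + 1))"
    using *[of "int (nat ((i - 1) mod int n) + 1)" "(i - 1) div int n"] by (simp only:)
  then show ?thesis using qext_index[OF assms(1), of i] by blast
qed

lemma unimodular_seq_qext:
  assumes "k \<ge> 1" "n = w + k + 1" "\<And>i. i \<in> {1..n} \<Longrightarrow> V i \<in> carrier_vec k"
    and win: "\<And>i. i \<in> {1..n} \<Longrightarrow> window_det k n V i = 1"
  shows "unimodular_seq k w n (qext k n V)"
proof
  have n: "n > 0" using assms by simp
  show "k \<ge> 1" "n = w + k + 1" by fact+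
  fix i
  show "qext k n V i \<in> carrier_vec k" using n assms by (intro qext_carrier)
  show "qext k n V (i + int n) = (- 1) ^ (k - 1) \<cdot>\<^sub>v qext k n V i" using n by (rule qext_shift)
  obtain j where "j \<in> {1..n}"
    "col_det k (\<lambda>c. qext k n V (i + int c)) = col_det k (\<lambda>c. qext k n V (int j + int c))"
    using int_periodic_cases[OF n, of "\<lambda>i. col_det k (\<lambda>c. qext k n V (i + int c))" i]
      col_det_qext_shift[OF n, of V k] assms(3) by auto
  then show "col_det k (\<lambda>c. qext k n V (i + int c)) = 1"
    using win[of j] by (simp add: window_det_eq_col_det)
qed

definition normal_configs :: "nat \<Rightarrow> nat \<Rightarrow> (nat \<Rightarrow> 'a::field vec) set" where
  "normal_configs k n = {V \<in> {1..n} \<rightarrow>\<^sub>E carrier_vec k.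
     (\<forall>i\<in>{1..n}. window_det k n V i = 1) \<and> (\<forall>c<k. V (Suc c) = unit_vec k c)}"

lemma unimodular_seq_normal_config:
  assumes "k \<ge> 1" "n = w + k + 1" "V \<in> normal_configs k n"
  shows "unimodular_seq k w n (qext k n V)"
  using assms by (intro unimodular_seq_qext) (auto simp: normal_configs_def PiE_iff)

text \<open>In a normalised configuration the linear forms can be read off from the first \<open>k\<close> columns
  of the frieze, and the remaining vectors are then recovered by solving a linear system.\<close>

lemma inj_on_seq_frieze:
  fixes k w n :: nat
  assumes "k \<ge> 1" "n = w + k + 1"
  shows "inj_on (\<lambda>V. seq_frieze k w (qext k n V)) (normal_configs k n :: (nat \<Rightarrow> 'a::field vec) set)"
proof (rule inj_onI)
  fix V V' :: "nat \<Rightarrow> 'a vec"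
  assume V: "V \<in> normal_configs k n" and V': "V' \<in> normal_configs k n"
    and eq: "seq_frieze k w (qext k n V) = seq_frieze k w (qext k n V')"
  interpret unimodular_seq k w n "qext k n V" by (rule unimodular_seq_normal_config[OF assms V])
  have entry: "seq_entry k (qext k n V) (1 + int r) (int m) = seq_entry k (qext k n V') (1 + int r) (int m)"
    if "r < k" "m \<in> {1..n}" for r m
  proof -
    have "int m - (1 + int r) \<in> frieze_rows k w" using that n by (auto simp: frieze_rows_def)
    then show ?thesis using fun_cong[OF fun_cong[OF eq], of "int m - (1 + int r)" "1 + int r"]
      by (simp add: seq_frieze_def)
  qed
  have form: "seq_entry k (qext k n X) i (int (Suc r)) = seq_form k (qext k n X) i r"
    if "r < k" "X \<in> normal_configs k n" for r i and X :: "nat \<Rightarrow> 'a vec"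
  proof -
    have "qext k n X (int (Suc r)) = unit_vec k r"
      using that n by (subst qext_base) (auto simp: normal_configs_def)
    then have "seq_entry k (qext k n X) i (int (Suc r)) =
        (\<Sum>s<k. if s = r then seq_form k (qext k n X) i s else 0)"
      using that unfolding seq_entry_def by (intro sum.cong) auto
    then show ?thesis using that by (simp add: sum.delta)
  qed
  have forms: "seq_form k (qext k n V) (1 + int r) s = seq_form k (qext k n V') (1 + int r) s"
    if "r < k" "s < k" for r s
    using entry[of r "Suc s"] form[OF _ V] form[OF _ V'] that n by simp
  have "V m = V' m" if m: "m \<in> {1..n}" for m
  proof (rule eq_vecI)
    have c: "V m \<in> carrier_vec k" "V' m \<in> carrier_vec k"
      using V V' m by (auto simp: normal_configs_def)
    then show "dim_vec (V m) = dim_vec (V' m)" by auto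
    fix r assume "r < dim_vec (V' m)"
    then have r: "r < k" using c by simp
    show "V m $ r = V' m $ r"
    proof (rule col_det_cancel[of k "\<lambda>c. vec k (\<lambda>s. seq_form k (qext k n V) (1 + int c) s)"])
      have "col_det k (\<lambda>c. vec k (\<lambda>s. seq_form k (qext k n V) (1 + int c) s)) =
          det ((mat k k (\<lambda>(r, c). seq_form k (qext k n V) (1 + int r) c))\<^sup>T)"
        unfolding col_det_def by (rule arg_cong[where f = det]) (rule eq_matI, auto)
      also have "\<dots> = 1" by (simp add: det_transpose[of _ k] det_seq_form)
      finally show "col_det k (\<lambda>c. vec k (\<lambda>s. seq_form k (qext k n V) (1 + int c) s)) \<noteq> 0" by simp
    next
      fix c assume c: "c < k"
      have "(\<Sum>r<k. seq_form k (qext k n V) (1 + int c) r * V m $ r) =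
          (\<Sum>r<k. seq_form k (qext k n V') (1 + int c) r * V' m $ r)"
        using entry[OF c m] by (simp add: seq_entry_def qext_base[OF m])
      also have "\<dots> = (\<Sum>r<k. seq_form k (qext k n V) (1 + int c) r * V' m $ r)"
        using forms c by simp
      finally show "(\<Sum>r<k. V m $ r * vec k (seq_form k (qext k n V) (1 + int c)) $ r) =
          (\<Sum>r<k. V' m $ r * vec k (seq_form k (qext k n V) (1 + int c)) $ r)"
        by (simp add: mult.commute)
    qed (rule r)
  qed
  then show "V = V'"
    using V V' by (intro PiE_ext[of V "{1..n}" _ V']) (auto simp: normal_configs_def)
qed

section \<open>Configurations from friezes\<close>

text \<open>The two vanishing conditions also kill both off-diagonal blocks. What remains is an
  upper triangular block of size \<open>t\<close> and a lower triangular block of size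
  \<open>k - t\<close>, each with unit diagonal.\<close>

lemma det_upper_lower_blocks:
  fixes A :: "'a::field mat"
  assumes A: "A \<in> carrier_mat k k" and "t \<le> k"
    and diag: "\<And>r. r < k \<Longrightarrow> A $$ (r, r) = 1"
    and upper: "\<And>r c. c < t \<Longrightarrow> c < r \<Longrightarrow> r < k \<Longrightarrow> A $$ (r, c) = 0"
    and lower: "\<And>r c. t \<le> c \<Longrightarrow> r < c \<Longrightarrow> c < k \<Longrightarrow> A $$ (r, c) = 0"
  shows "det A = 1"
proof -
  define B where "B = mat t t (\<lambda>(r, c). A $$ (r, c))"
  define C where "C = mat (k - t) (k - t) (\<lambda>(r, c). A $$ (r + t, c + t))"
  have BC: "B \<in> carrier_mat t t" "C \<in> carrier_mat (k - t) (k - t)"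
    by (auto simp: B_def C_def)
  have "A = four_block_mat B (0\<^sub>m t (k - t)) (0\<^sub>m (k - t) t) C"
    by (rule eq_matI) (use A \<open>t \<le> k\<close> upper lower in \<open>auto simp: B_def C_def\<close>)
  then have "det A = det B * det C"
    using det_four_block_mat_lower_left_zero[OF BC(1) _ refl BC(2), of "0\<^sub>m t (k - t)"] by simp
  also have "det B = 1"
  proof (rule det_eq_1_of_triangular[OF BC(1)])
    show "(\<forall>r<t. \<forall>c<r. B $$ (r, c) = 0) \<or> (\<forall>c<t. \<forall>r<c. B $$ (r, c) = 0)"
      using upper \<open>t \<le> k\<close> by (auto simp: B_def)
  qed (use diag \<open>t \<le> k\<close> in \<open>auto simp: B_def\<close>)
  also have "det C = 1"
  proof (rule det_eq_1_of_triangular[OF BC(2)])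
    show "(\<forall>r<k-t. \<forall>c<r. C $$ (r, c) = 0) \<or> (\<forall>c<k-t. \<forall>r<c. C $$ (r, c) = 0)"
      using lower by (intro disjI2) (auto simp: C_def)
  qed (use diag in \<open>auto simp: C_def\<close>)
  finally show ?thesis by simp
qed

text \<open>Column \<open>m\<close> of M restricted to rows 1, ..., \<open>k\<close>: the vector
  with index \<open>m\<close> in the coordinates given by the forms at positions 1, ...,
  \<open>k\<close>.\<close>

definition frieze_col :: "nat \<Rightarrow> (int \<Rightarrow> int \<Rightarrow> 'a::field) \<Rightarrow> nat \<Rightarrow> 'a vec" where
  "frieze_col k e m = vec k (\<lambda>r. e (int m - 1 - int r) (1 + int r))"

lemma window_det_frieze_col:
  fixes e :: "int \<Rightarrow> int \<Rightarrow> 'a::field"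
  assumes "k \<ge> 1" and n: "n = w + k + 1" and e: "e \<in> tame_friezes k w" and i: "i \<in> {1..n}"
  shows "window_det k n (frieze_col k e) i = 1"
proof (cases "i \<le> w + 2")
  \<comment> \<open>The bound says that the window ends at \<open>n\<close> at the latest; it is
    then a \<open>k\<close>-diamond of the frieze at position 1.\<close>
  case True
  have "window_det k n (frieze_col k e) i = det (diamond e k (int i - 1) 1)"
    unfolding window_det_eq_col_det[of i] col_det_def diamond_def
    using i
  proof (simp add: window_det_eq_col_det col_det_def diamond_def, intro arg_cong[where f = det] cong_mat)
    fix r c assume "r < k" "c < k"
    moreover have "qext k n (frieze_col k e) (int i + int c) = frieze_col k e (i + c)"
      using qext_base[of "i + c" n k "frieze_col k e"] \<open>c < k\<close> True n i by simp
    ultimately show "(case (r, c) of (r, c) \<Rightarrow> qext k n (frieze_col k e) (int i + int c) $ r) =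
        (case (r, c) of (r, c) \<Rightarrow> e (int i - 1 + int c - int r) (1 + int r))"
      by (simp add: frieze_col_def algebra_simps)
  qed auto
  then show ?thesis using frieze_diamond[OF e, of "int i - 1" 1] True i by simp
next
  case False
  \<comment> \<open>This window wraps around. Rotating its columns absorbs the signs of the quasi-period and leaves
    a block diagonal matrix.\<close>
  define t where "t = i - (w + 2)"
  have t: "i = w + 2 + t" "t < k" "t > 0" using False i n by (auto simp: t_def)
  let ?V = "frieze_col k e"
  \<comment> \<open>The window consists of the vectors \<open>w + 2 + t\<close>, ...,
    \<open>n\<close> followed by the signed vectors 1, ..., \<open>t\<close>. \<open>Y\<close> lists
    the latter first without sign, and \<open>X\<close> continues \<open>Y\<close> with quasi-period
    \<open>k\<close>, so that the window is \<open>X\<close> read from index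
    \<open>t\<close>.\<close>
  define Y where "Y c = (if c < t then ?V (Suc c) else ?V (w + 2 + c))" for c
  define X where "X c = (if c < k then Y c else (-1) ^ (k - 1) \<cdot>\<^sub>v Y (c - k))" for c
  have "window_det k n ?V i = col_det k (\<lambda>c. X (t + c))"
  proof -
    have "qext k n ?V (int i + int c) = X (t + c)" if "c < k" for c
    proof (cases "t + c < k")
      case True
      then show ?thesis using qext_base[of "i + c" n k ?V] t n by (simp add: X_def Y_def add.assoc)
    next
      case False
      define m where "m = Suc (t + c - k)"
      have m: "i + c = m + n" "m \<in> {1..n}" "m \<le> t" "t + c - k = m - 1"
        using False t n that by (auto simp: m_def)
      have "qext k n ?V (int i + int c) = qext k n ?V (int m + int n)"
        using m(1) by (metis of_nat_add)
      also have "\<dots> = (-1) ^ (k - 1) \<cdot>\<^sub>v ?V m"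
        using qext_shift[of n k ?V "int m"] qext_base[OF m(2), of k ?V] n by simp
      also have "\<dots> = X (t + c)" using False m by (auto simp: X_def Y_def)
      finally show ?thesis .
    qed
    then show ?thesis using i by (subst window_det_eq_col_det) (auto intro!: col_det_cong)
  qed
  also have "\<dots> = col_det k X"
    by (rule col_det_rotate) (use \<open>k \<ge> 1\<close> t in \<open>auto simp: X_def Y_def frieze_col_def\<close>)
  \<comment> \<open>For \<open>c < t\<close> entry \<open>r\<close> of column \<open>c\<close> lies
    in frieze row \<open>c - r\<close>, otherwise in frieze row \<open>w + 1 + c - r\<close>. The
    diagonal meets rows 0 and \<open>w + 1\<close>; the zero rows below 0 and above
    \<open>w + 1\<close> give the two triangular shapes.\<close>
  also have "\<dots> = 1"
    unfolding col_det_def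
    by (rule det_upper_lower_blocks[of _ k t])
      (use t in \<open>auto simp: X_def Y_def frieze_col_def frieze_1[OF e] add.commute[of 1] frieze_0[OF e] frieze_0'[OF e]\<close>)
  finally show ?thesis .
qed

text \<open>The form at \<open>1 + r\<close> and the \<open>r\<close>-th coordinate agree on the
  basis of the \<open>k\<close> vectors with indices up to \<open>1 + r\<close>: both vanish on all
  but the last, where both are 1.\<close>

lemma seq_form_frieze_col:
  fixes e :: "int \<Rightarrow> int \<Rightarrow> 'a::field"
  assumes "k \<ge> 1" and n: "n = w + k + 1" and e: "e \<in> tame_friezes k w" and r: "r < k" "s < k"
  shows "seq_form k (qext k n (frieze_col k e)) (1 + int r) s = (if s = r then 1 else 0)"
proof -
  let ?V = "frieze_col k e"
  let ?U = "qext k n ?V"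
  interpret unimodular_seq k w n ?U
    using assms by (intro unimodular_seq_qext window_det_frieze_col) (auto simp: frieze_col_def)
  show ?thesis
  proof (rule col_det_cancel[where X = "\<lambda>c. ?U (1 + int r - int k + 1 + int c)" and r = s
        and x = "seq_form k ?U (1 + int r)" and y = "\<lambda>s. if s = r then 1 else 0"])
    show "col_det k (\<lambda>c. ?U (1 + int r - int k + 1 + int c)) \<noteq> 0"
      using window[of "1 + int r - int k + 1"] by simp
    fix c assume c: "c < k"
    let ?m = "1 + int r - int k + 1 + int c"
    have "?U ?m $ r = (if c = k - 1 then 1 else 0)"
    proof (cases "?m \<ge> 1")
      case True
      then have "?U ?m = ?V (nat ?m)" using n r c by (intro qext_base_int) auto
      moreover have "?V (nat ?m) $ r = e (?m - 1 - int r) (1 + int r)"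
        using True r by (simp add: frieze_col_def)
      moreover have "?m - 1 - int r = 0 \<longleftrightarrow> c = k - 1" using c by auto
      moreover have "- int k < ?m - 1 - int r" "?m - 1 - int r \<le> 0" using c by auto
      ultimately show ?thesis using frieze_1[OF e] frieze_0[OF e, of "?m - 1 - int r"]
        by (cases "c = k - 1") auto
    next
      case False
      \<comment> \<open>A nonpositive index is moved into \<open>{1..n}\<close> by one period; the
        coordinate then lies in frieze row \<open>w + 2 + c\<close>, one of the zero rows at the
        top.\<close>
      have "?U (?m + int n) = ?V (nat (?m + int n))"
        using n r c False by (intro qext_base_int) auto
      moreover have "?V (nat (?m + int n)) $ r = e (?m + int n - 1 - int r) (1 + int r)"
        using False r n by (simp add: frieze_col_def)
      moreover have "e (?m + int n - 1 - int r) (1 + int r) = 0"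
        using False r n by (intro frieze_0'[OF e]) auto
      moreover have "?U (?m + int n) $ r = (-1) ^ (k - 1) * ?U ?m $ r"
        unfolding shift using carrier[of ?m] r by simp
      ultimately have "?U ?m $ r = 0" by simp
      then show ?thesis using False r by auto
    qed
    moreover have "(\<Sum>s<k. seq_form k ?U (1 + int r) s * ?U ?m $ s) = (if c = k - 1 then 1 else 0)"
    proof (cases "c = k - 1")
      case True
      then have "?m = 1 + int r" using k by auto
      then show ?thesis using seq_entry_diag[of "1 + int r"] True unfolding seq_entry_def by simp
    next
      case False
      then show ?thesis using seq_entry_0[of "1 + int r" ?m] c unfolding seq_entry_def by simp
    qed
    moreover have "(\<Sum>s<k. (if s = r then 1 else 0) * ?U ?m $ s) = ?U ?m $ r"
      using r by (simp add: if_distrib[of "\<lambda>x. x * _"] sum.delta cong: if_cong)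
    ultimately show "(\<Sum>s<k. seq_form k ?U (1 + int r) s * ?U ?m $ s) =
        (\<Sum>s<k. (if s = r then 1 else 0) * ?U ?m $ s)" by simp
  qed (rule r)
qed

text \<open>By rigidity only rows 1, ..., \<open>w\<close> at positions 1, ..., \<open>k\<close>
  need comparison, and there the forms are coordinate forms.\<close>

lemma seq_frieze_frieze_col:
  assumes "k \<ge> 1" and n: "n = w + k + 1" and e: "e \<in> tame_friezes k w"
  shows "seq_frieze k w (qext k n (frieze_col k e)) = e"
proof -
  let ?U = "qext k n (frieze_col k e)"
  interpret unimodular_seq k w n ?U
    using assms by (intro unimodular_seq_qext window_det_frieze_col) (auto simp: frieze_col_def)
  show ?thesis
  proof (rule frieze_eqI[OF seq_frieze_tame e])
    fix j r assume r: "r < k" and j: "1 \<le> j" "j \<le> int w"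
    define m where "m = nat (1 + int r + j)"
    have m: "int m = 1 + int r + j" "m \<in> {1..n}" using j r n by (auto simp: m_def)
    have "seq_frieze k w ?U j (1 + int r) = seq_entry k ?U (1 + int r) (int m)"
      using j m by (simp add: seq_frieze_def frieze_rows_def)
    also have "\<dots> = (\<Sum>s<k. if s = r then frieze_col k e m $ s else 0)"
      unfolding seq_entry_def qext_base[OF m(2)]
      by (intro sum.cong refl) (use seq_form_frieze_col[OF assms r] in auto)
    also have "\<dots> = e j (1 + int r)"
      using r m by (simp add: sum.delta frieze_col_def)
    finally show "seq_frieze k w ?U j (1 + int r) = e j (1 + int r)" .
  qed
qed

text \<open>Each entry is itself a determinant of \<open>k\<close> vectors of the sequence, so
  \<open>B\<close> multiplies it by \<open>det B\<close>.\<close>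

lemma seq_frieze_mult_mat_vec:
  assumes B: "B \<in> carrier_mat k k" "det B = 1" and "k \<ge> 1" and U: "\<And>i. U i \<in> carrier_vec k"
  shows "seq_frieze k w (\<lambda>i. B *\<^sub>v U i) = seq_frieze k w U"
proof -
  have "seq_entry k (\<lambda>i. B *\<^sub>v U i) i m = seq_entry k U i m" for i m
  proof -
    have "seq_entry k (\<lambda>i. B *\<^sub>v U i) i m =
        col_det k ((\<lambda>c. B *\<^sub>v U (i - int k + 1 + int c))(k - 1 := B *\<^sub>v U m))"
      unfolding seq_entry_def seq_form_def by (rule last_form_expand[OF \<open>k \<ge> 1\<close>])
    also have "\<dots> = col_det k (\<lambda>c. B *\<^sub>v ((\<lambda>c. U (i - int k + 1 + int c))(k - 1 := U m)) c)"
      by (rule col_det_cong) auto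
    also have "\<dots> = col_det k ((\<lambda>c. U (i - int k + 1 + int c))(k - 1 := U m))"
      by (subst col_det_mult_mat_vec) (use B U in auto)
    also have "\<dots> = seq_entry k U i m"
      unfolding seq_entry_def seq_form_def by (rule last_form_expand[OF \<open>k \<ge> 1\<close>, symmetric])
    finally show ?thesis .
  qed
  then show ?thesis by (intro ext) (simp add: seq_frieze_def)
qed

lemma mat_inverse_exists:
  fixes A :: "'a::field mat"
  assumes A: "A \<in> carrier_mat k k" "det A \<noteq> 0"
  obtains B where "B \<in> carrier_mat k k" "B * A = 1\<^sub>m k" "A * B = 1\<^sub>m k" "det B = inverse (det A)"
proof -
  obtain B where B: "B \<in> carrier_mat k k" "B * A = 1\<^sub>m k" "A * B = 1\<^sub>m k"
    using det_non_zero_imp_unit[OF A, of "()"] by (auto simp: Units_def ring_mat_def)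
  have "det B * det A = 1" using det_mult[OF B(1) A(1)] B(2) by simp
  then have "det B = inverse (det A)" by (metis inverse_unique mult.commute)
  then show thesis using that B by blast
qed

text \<open>\<open>A\<close> has the first \<open>k\<close> vectors as columns, so its determinant
  is the first window. The value \<open>b = 1\<close> serves the friezes, general \<open>b\<close>
  the action of GL_k.\<close>

lemma normalise_config:
  fixes V :: "nat \<Rightarrow> 'a::field vec"
  assumes "k \<le> n" "n > 0" and V: "\<And>i. i \<in> {1..n} \<Longrightarrow> V i \<in> carrier_vec k"
    and b: "b \<noteq> 0" "\<And>i. i \<in> {1..n} \<Longrightarrow> window_det k n V i = b"
  obtains A B where "A \<in> carrier_mat k k" "B \<in> carrier_mat k k" "B * A = 1\<^sub>m k" "A * B = 1\<^sub>m k"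
    "det A = b" "(\<lambda>i\<in>{1..n}. B *\<^sub>v V i) \<in> normal_configs k n"
proof -
  define A where "A = mat k k (\<lambda>(r, c). V (Suc c) $ r)"
  have A: "A \<in> carrier_mat k k" by (simp add: A_def)
  have "window_det k n V 1 = col_det k (\<lambda>c. V (Suc c))"
  proof -
    have "qext k n V (int 1 + int c) = V (Suc c)" if "c < k" for c
      using qext_base[of "Suc c" n k V] that assms(1) by simp
    then show ?thesis by (subst window_det_eq_col_det) (auto intro!: col_det_cong)
  qed
  then have detA: "det A = b" using b(2)[of 1] \<open>n > 0\<close> by (simp add: A_def col_det_def)
  then obtain B where B: "B \<in> carrier_mat k k" "B * A = 1\<^sub>m k" "A * B = 1\<^sub>m k" "det B = inverse b"
    using mat_inverse_exists[OF A] b(1) by metis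
  have "(\<lambda>i\<in>{1..n}. B *\<^sub>v V i) \<in> normal_configs k n"
    unfolding normal_configs_def
  proof (intro CollectI conjI ballI allI impI)
    show "(\<lambda>i\<in>{1..n}. B *\<^sub>v V i) \<in> {1..n} \<rightarrow>\<^sub>E carrier_vec k"
      using B(1) V by auto
    fix i assume "i \<in> {1..n}"
    then show "window_det k n (\<lambda>i\<in>{1..n}. B *\<^sub>v V i) i = 1"
      using B b V \<open>n > 0\<close> by (subst window_det_mult_mat_vec) auto
  next
    fix c assume c: "c < k"
    have "V (Suc c) \<in> carrier_vec k" using V[of "Suc c"] c \<open>k \<le> n\<close> by simp
    then have "V (Suc c) = A *\<^sub>v unit_vec k c"
      using c A by (intro eq_vecI) (auto simp: A_def)
    then have "B *\<^sub>v V (Suc c) = (B * A) *\<^sub>v unit_vec k c"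
      using A B(1) by (simp add: assoc_mult_mat_vec[of _ k k _ k])
    then show "(\<lambda>i\<in>{1..n}. B *\<^sub>v V i) (Suc c) = unit_vec k c"
      using c \<open>k \<le> n\<close> B(2) by simp
  qed
  then show thesis using that A B detA by blast
qed

text \<open>The vectors \<open>frieze_col\<close> need not start with the standard basis; their
  coordinates come from the forms. A change of basis of determinant 1 repairs this without altering
  the frieze.\<close>

lemma bij_betw_seq_frieze:
  fixes k w n :: nat
  assumes "k \<ge> 1" "n = w + k + 1"
  shows "bij_betw (\<lambda>V. seq_frieze k w (qext k n V))
    (normal_configs k n) (tame_friezes k w :: (int \<Rightarrow> int \<Rightarrow> 'a::field) set)"
proof (intro bij_betw_imageI inj_on_seq_frieze[OF assms] equalityI subsetI)
  fix e :: "int \<Rightarrow> int \<Rightarrow> 'a"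
  assume "e \<in> (\<lambda>V. seq_frieze k w (qext k n V)) ` normal_configs k n"
  then show "e \<in> tame_friezes k w"
    using unimodular_seq_normal_config[OF assms] unimodular_seq.seq_frieze_tame by blast
next
  fix e :: "int \<Rightarrow> int \<Rightarrow> 'a"
  assume e: "e \<in> tame_friezes k w"
  let ?V = "frieze_col k e"
  have V: "?V i \<in> carrier_vec k" for i by (simp add: frieze_col_def)
  have n: "k \<le> n" "n > 0" using assms by auto
  obtain A B where A: "A \<in> carrier_mat k k" "det A = 1"
    and B: "B \<in> carrier_mat k k" "B * A = 1\<^sub>m k"
    and norm: "(\<lambda>i\<in>{1..n}. B *\<^sub>v ?V i) \<in> normal_configs k n"
    using normalise_config[OF n V one_neq_zero window_det_frieze_col[OF assms e]] by blast
  have "det B = 1" using det_mult[OF B(1) A(1)] A(2) B(2) by simp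
  have "qext k n (\<lambda>i\<in>{1..n}. B *\<^sub>v ?V i) = (\<lambda>i. B *\<^sub>v qext k n ?V i)"
    using B(1) n V by (intro ext qext_mult_mat_vec)
  then have "seq_frieze k w (qext k n (\<lambda>i\<in>{1..n}. B *\<^sub>v ?V i)) = seq_frieze k w (qext k n ?V)"
    using B(1) \<open>det B = 1\<close> assms(1) n V by (simp add: seq_frieze_mult_mat_vec qext_carrier)
  also have "\<dots> = e" by (rule seq_frieze_frieze_col[OF assms e])
  finally show "e \<in> (\<lambda>V. seq_frieze k w (qext k n V)) ` normal_configs k n"
    by (intro image_eqI[OF _ norm]) simp
qed

section \<open>Solving the scaling equations\<close>

lemma prod_lessThan_shift:
  fixes f :: "nat \<Rightarrow> 'a::comm_monoid_mult"
  assumes "f m = f 0"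
  shows "(\<Prod>t<m. f (Suc t)) = (\<Prod>t<m. f t)"
proof (cases m)
  case (Suc m')
  have "(\<Prod>t<m. f (Suc t)) = (\<Prod>t<m'. f (Suc t)) * f 0" using assms by (simp add: Suc)
  then show ?thesis unfolding Suc by (simp only: prod.lessThan_Suc_shift mult.commute)
qed simp

lemma periodic_mod:
  fixes F :: "nat \<Rightarrow> 'b"
  assumes "\<And>j. F (j + n) = F j"
  shows "F (j mod n) = F j"
proof -
  have "F (i + n * t) = F i" for i t
  proof (induction t)
    case (Suc t)
    then show ?case using assms[of "i + n * t"] by (simp add: algebra_simps)
  qed simp
  from this[of "j mod n" "j div n"] show ?thesis by simp
qed

lemma prod_consecutive_shift:
  fixes F :: "nat \<Rightarrow> 'a::field"
  shows "(\<Prod>l<k. F (Suc j + l)) * F j = (\<Prod>l<k. F (j + l)) * F (j + k)"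
  using prod.lessThan_Suc_shift[of "\<lambda>l. F (j + l)" k] by (simp add: mult.commute)

lemma prod_class_shift:
  fixes F :: "nat \<Rightarrow> 'a::field"
  assumes per: "\<And>j. F (j + n) = F j" and "g dvd n"
  shows "(\<Prod>t<n div g. F (j + g + t * g)) = (\<Prod>t<n div g. F (j + t * g))"
proof -
  have "F (j + n div g * g) = F (j + 0 * g)" using assms by simp
  from prod_lessThan_shift[of "\<lambda>t. F (j + t * g)", OF this] show ?thesis
    by (simp add: add.assoc)
qed

text \<open>After swapping the products, each side is a product of \<open>k\<close> consecutive
  class products of \<open>F\<close>. These have period \<open>g\<close>, which divides
  \<open>k\<close>, so the window can slide. This makes the balance condition invariant under
  scaling.\<close>

lemma prod_class_of_consecutive:
  fixes F :: "nat \<Rightarrow> 'a::field"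
  assumes per: "\<And>j. F (j + n) = F j" and g: "g dvd n" "g dvd k"
  shows "(\<Prod>t<n div g. \<Prod>l<k. F (Suc j + t * g + l)) = (\<Prod>t<n div g. \<Prod>l<k. F (j + t * g + l))"
proof -
  define R where "R j = (\<Prod>t<n div g. F (j + t * g))" for j
  have swap: "(\<Prod>t<n div g. \<Prod>l<k. F (j + t * g + l)) = (\<Prod>l<k. R (j + l))" for j
    unfolding R_def by (subst prod.swap) (simp add: algebra_simps)
  have "R (j + g * m) = R j" for j m
  proof (induction m)
    case (Suc m)
    have "R (j + g * Suc m) = R (j + g * m)"
      using prod_class_shift[of F n g "j + g * m", OF per g(1)] by (simp add: R_def ac_simps)
    then show ?case using Suc by simp
  qed simp
  then have "R (j + k) = R j" using g(2) by (metis dvd_def)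
  then show ?thesis
    unfolding swap using prod_lessThan_shift[of "\<lambda>l. R (j + l)" k] by simp
qed

lemma prod_mult_mod_coprime:
  fixes h :: "nat \<Rightarrow> 'a::comm_monoid_mult"
  assumes "coprime a N" and per: "\<And>y. h (y mod N) = h y"
  shows "(\<Prod>u<N. h (a * u)) = (\<Prod>u<N. h u)"
proof -
  have inj: "inj_on (\<lambda>u. a * u mod N) {..<N}"
  proof (rule inj_onI)
    fix x y assume xy: "x \<in> {..<N}" "y \<in> {..<N}" "a * x mod N = a * y mod N"
    then have "[x = y] (mod N)"
      using cong_mult_lcancel_nat[OF assms(1)] by (simp add: cong_def)
    then show "x = y" using xy by (simp add: cong_def)
  qed
  have "(\<lambda>u. a * u mod N) ` {..<N} = {..<N}"
    by (rule endo_inj_surj[OF _ _ inj]) auto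
  then have "(\<Prod>u<N. h u) = (\<Prod>u<N. h (a * u mod N))"
    using prod.reindex[OF inj, of h] by simp
  then show ?thesis by (simp add: per)
qed

text \<open>Dividing consecutive equations \<open>\<Prod>l<k. x (j + l) = b * m j\<close> turns them into the recursion
  \<open>x (j + k) = x j * (m (j + 1) / m j)\<close>. Along the orbits of \<open>j \<mapsto> j + k\<close>, which are the residue
  classes modulo \<open>g\<close>, it can be solved uniquely with prescribed \<open>x 0, \<dots>, x (g - 1)\<close>, because the
  quotients multiply to 1 over every class.\<close>

context
  fixes k n g :: nat and M :: "nat \<Rightarrow> 'a::field"
  assumes n: "n > 0" and g: "g = gcd k n"
    and per: "\<And>j. M (j + n) = M j" and nz: "\<And>j. M j \<noteq> 0"
    and cls: "\<And>r. Suc r < g \<Longrightarrow> (\<Prod>t<n div g. M (Suc r + t * g)) = (\<Prod>t<n div g. M (r + t * g))"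
begin

lemma gcd_pos: "g > 0" using n g by simp

lemma gcd_mult_div: "g * (n div g) = n" "g * (k div g) = k"
  using g by auto

lemma step_mod: "M (Suc j mod n) / M (j mod n) = M (Suc j) / M j"
proof -
  have "M (j mod n) = M j" for j by (rule periodic_mod) (rule per)
  then show ?thesis by simp
qed

lemma step_cong:
  assumes "[i = j] (mod n)"
  shows "M (Suc i) / M i = M (Suc j) / M j"
proof -
  have "i mod n = j mod n" "Suc i mod n = Suc j mod n"
    using assms cong_add_lcancel_nat[of 1 i j n] by (auto simp: cong_def)
  then show ?thesis using step_mod[of i] step_mod[of j] by simp
qed

text \<open>The product is the quotient of two neighbouring class products. \<open>cls\<close>
  compares classes 0, ..., \<open>g - 1\<close>; the last step, from class \<open>g - 1\<close> to
  \<open>g\<close>, closes up by periodicity.\<close>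

lemma prod_step_class: "(\<Prod>u<n div g. M (Suc (r + g * u)) / M (r + g * u)) = 1" if "r < g"
proof -
  define R where "R r = (\<Prod>t<n div g. M (r + t * g))" for r
  have eq0: "R r = R 0" if "r < g" for r using that
  proof (induction r)
    case (Suc r)
    then show ?case using cls[of r] by (simp add: R_def)
  qed simp
  have "R (Suc r) = R r"
  proof (cases "Suc r < g")
    case True then show ?thesis using eq0[of r] eq0[of "Suc r"] by simp
  next
    case False
    then have "Suc r = g" using that by simp
    then have "R (Suc r) = R 0"
      using prod_class_shift[of M n g 0, OF per] g by (simp add: R_def)
    then show ?thesis using eq0[OF that] by simp
  qed
  moreover have "R r \<noteq> 0" unfolding R_def using nz by simp
  ultimately show ?thesis
    unfolding prod_dividef R_def by (simp add: mult.commute)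
qed

text \<open>Steps of length \<open>k\<close> visit the residue class of \<open>r\<close> modulo
  \<open>g\<close> in another order, since \<open>k div g\<close> is a unit modulo
  \<open>n div g\<close>.\<close>

lemma prod_step_orbit:
  assumes "r < g"
  shows "(\<Prod>u<n div g. M (Suc (r + k * u)) / M (r + k * u)) = 1"
proof -
  define h where "h y = M (Suc (r + g * y)) / M (r + g * y)" for y
  have "coprime (k div g) (n div g)"
    unfolding g by (rule div_gcd_coprime) (use n in auto)
  moreover have "h (y mod (n div g)) = h y" for y
  proof -
    have "g * (y mod (n div g)) mod n = g * y mod n"
      using mult_mod_right[of g y "n div g"] gcd_mult_div by simp
    then have "[r + g * (y mod (n div g)) = r + g * y] (mod n)"
      using cong_add_lcancel_nat by (simp add: cong_def)
    then show ?thesis unfolding h_def by (rule step_cong)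
  qed
  ultimately have "(\<Prod>u<n div g. h (k div g * u)) = (\<Prod>u<n div g. h u)"
    by (rule prod_mult_mod_coprime)
  moreover have "h (k div g * u) = M (Suc (r + k * u)) / M (r + k * u)" for u
    unfolding h_def using gcd_mult_div(2) by (metis mult.assoc)
  ultimately show ?thesis using prod_step_class[OF assms] by (simp add: h_def)
qed

text \<open>\<open>a\<close> inverts \<open>k div g\<close> modulo \<open>n div g\<close>, so
  \<open>a * (j div g)\<close> counts the steps of length \<open>k\<close> that lead from
  \<open>j mod g\<close> to \<open>j\<close>.\<close>

lemma orbit_index:
  obtains a where "\<And>j. [j mod g + k * (a * (j div g) mod (n div g)) = j] (mod n)"
    "[a * (k div g) = 1] (mod n div g)"
proof -
  obtain a where a: "[k * a = g] (mod n)" using cong_solve_nat[of k n] n g by auto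
  show thesis
  proof (rule that)
    fix j
    have "[k * (a * (j div g) mod (n div g)) = k * (a * (j div g))] (mod n)"
    proof -
      have "[a * (j div g) mod (n div g) = a * (j div g)] (mod n div g)" by (simp add: cong_def)
      then have "[g * (a * (j div g) mod (n div g)) = g * (a * (j div g))] (mod n)"
        using gcd_mult_div(1) mult_mod_right[of g] by (metis cong_def)
      then have "[(k div g) * (g * (a * (j div g) mod (n div g))) = (k div g) * (g * (a * (j div g)))] (mod n)"
        by (rule cong_scalar_left)
      then show ?thesis using gcd_mult_div(2) by (metis mult.assoc mult.commute)
    qed
    also have "[k * (a * (j div g)) = g * (j div g)] (mod n)"
      using cong_scalar_right[OF a, of "j div g"] by (simp add: mult.assoc)
    finally have "[j mod g + k * (a * (j div g) mod (n div g)) = j mod g + g * (j div g)] (mod n)"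
      by (simp only: cong_add_lcancel_nat)
    then show "[j mod g + k * (a * (j div g) mod (n div g)) = j] (mod n)" by simp
  next
    have "[g * (a * (k div g)) = g * 1] (mod g * (n div g))"
      using a gcd_mult_div by (metis mult.assoc mult.commute mult.right_neutral)
    then show "[a * (k div g) = 1] (mod n div g)"
      using gcd_pos by (simp add: cong_def mult_mod_right[symmetric])
  qed
qed

definition recurrence_solutions :: "(nat \<Rightarrow> 'a) set" where
  "recurrence_solutions = {x \<in> {1..n} \<rightarrow>\<^sub>E UNIV - {0}.
     \<forall>j. x (Suc ((j + k) mod n)) = x (Suc (j mod n)) * (M (Suc j) / M j)}"

lemma recurrence_orbit:
  assumes x: "x \<in> recurrence_solutions"
  shows "x (Suc ((r + k * s) mod n)) = x (Suc (r mod n)) * (\<Prod>u<s. M (Suc (r + k * u)) / M (r + k * u))"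
proof (induction s)
  case (Suc s)
  have "x (Suc ((r + k * Suc s) mod n)) = x (Suc ((r + k * s + k) mod n))" by (simp add: algebra_simps)
  also have "\<dots> = x (Suc ((r + k * s) mod n)) * (M (Suc (r + k * s)) / M (r + k * s))"
    using x unfolding recurrence_solutions_def by blast
  finally show ?case unfolding Suc by (simp add: mult.assoc)
qed simp

lemma bij_betw_recurrence_solutions:
  "bij_betw (\<lambda>x. \<lambda>r\<in>{..<g}. x (Suc r)) recurrence_solutions ({..<g} \<rightarrow>\<^sub>E UNIV - {0})"
proof -
  obtain a where a: "\<And>j. [j mod g + k * (a * (j div g) mod (n div g)) = j] (mod n)"
    and a1: "[a * (k div g) = 1] (mod n div g)" using orbit_index by blast
  have gn: "g \<le> n" using g n by (simp add: gcd_le2_nat)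
  show ?thesis
  proof (intro bij_betw_imageI inj_onI equalityI subsetI)
    fix x y
    assume x: "x \<in> recurrence_solutions" and y: "y \<in> recurrence_solutions"
      and eq: "(\<lambda>r\<in>{..<g}. x (Suc r)) = (\<lambda>r\<in>{..<g}. y (Suc r))"
    have eqr: "x (Suc r) = y (Suc r)" if "r < g" for r
      using fun_cong[OF eq, of r] that by simp
    show "x = y"
    proof (rule PiE_ext[of x "{1..n}" _ y])
      show "x \<in> {1..n} \<rightarrow>\<^sub>E UNIV - {0}" "y \<in> {1..n} \<rightarrow>\<^sub>E UNIV - {0}"
        using x y by (auto simp: recurrence_solutions_def)
      fix i assume i: "i \<in> {1..n}"
      define j where "j = i - 1"
      have j: "i = Suc j" "j < n" using i by (auto simp: j_def)
      define s where "s = a * (j div g) mod (n div g)"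
      have r: "j mod g < g" using gcd_pos by simp
      have "(j mod g + k * s) mod n = j"
        using a[of j] j by (simp add: cong_def s_def)
      moreover have "j mod g mod n = j mod g" using r gn by simp
      ultimately show "x i = y i"
        using recurrence_orbit[OF x, of "j mod g" s] recurrence_orbit[OF y, of "j mod g" s]
          eqr[OF r] by (simp only: j)
    qed
  next
    fix z assume "z \<in> (\<lambda>x. \<lambda>r\<in>{..<g}. x (Suc r)) ` recurrence_solutions"
    then show "z \<in> {..<g} \<rightarrow>\<^sub>E UNIV - {0}"
      using gn by (auto simp: recurrence_solutions_def PiE_iff)
  next
    fix z assume z: "z \<in> {..<g} \<rightarrow>\<^sub>E UNIV - {0 :: 'a}"
    \<comment> \<open>The recursion unrolled along the orbit from its starting point
      \<open>j mod g\<close>.\<close>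
    define y where "y j = z (j mod g) *
      (\<Prod>u<a * (j div g) mod (n div g). M (Suc (j mod g + k * u)) / M (j mod g + k * u))" for j
    have y_per: "y (j + n) = y j" for j
    proof -
      have "(j + n) mod g = j mod g" "(j + n) div g = j div g + n div g"
        using mod_mult_self2[of j g "n div g"] g
        by (simp_all add: gcd_mult_div div_plus_div_distrib_dvd_right)
      then show ?thesis by (simp add: y_def distrib_left)
    qed
    then have y_mod: "y (j mod n) = y j" for j by (rule periodic_mod)
    have y_step: "y (j + k) = y j * (M (Suc j) / M j)" for j
    proof -
      define r s where "r = j mod g" and "s = a * (j div g) mod (n div g)"
      have "n div g > 0" using gcd_mult_div(1) n by (metis gr0I mult_0_right less_irrefl)
      have r: "r < g" using gcd_pos by (simp add: r_def)
      have s: "s < n div g" using \<open>n div g > 0\<close> by (simp add: s_def)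
      have "(j + k) mod g = r" "(j + k) div g = j div g + k div g"
        using mod_mult_self2[of j g "k div g"] g
        by (simp_all add: r_def gcd_mult_div div_plus_div_distrib_dvd_right)
      moreover have "a * (j div g + k div g) mod (n div g) = Suc s mod (n div g)"
        using a1 unfolding s_def by (metis Suc_eq_plus1 cong_def distrib_left mod_add_eq mod_add_left_eq mod_mod_trivial)
      ultimately have yk: "y (j + k) = z r * (\<Prod>u<Suc s mod (n div g). M (Suc (r + k * u)) / M (r + k * u))"
        by (simp add: y_def)
      have "[r + k * s = j] (mod n)" using a[of j] by (simp add: r_def s_def)
      then have "M (Suc j) / M j = M (Suc (r + k * s)) / M (r + k * s)"
        using step_cong by (metis cong_sym)
      then have yj: "y j * (M (Suc j) / M j) = z r * (\<Prod>u<Suc s. M (Suc (r + k * u)) / M (r + k * u))"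
        by (simp add: y_def r_def[symmetric] s_def[symmetric])
      \<comment> \<open>If \<open>Suc s\<close> equals the orbit length, the step returns to the
        starting point; consistency is the statement that the orbit product is 1.\<close>
      show ?thesis
      proof (cases "Suc s = n div g")
        case True
        then show ?thesis using yk yj prod_step_orbit[OF r] by simp
      next
        case False
        then have "Suc s mod (n div g) = Suc s" using s by simp
        then show ?thesis using yk yj by simp
      qed
    qed
    define x where "x = (\<lambda>i\<in>{1..n}. y (i - 1))"
    have x: "x (Suc (j mod n)) = y j" for j
      using n y_mod[of j] by (simp add: x_def Suc_le_eq)
    have "y j \<noteq> 0" for j
      using z gcd_pos nz by (auto simp: y_def PiE_iff)
    then have "x \<in> recurrence_solutions"
      unfolding recurrence_solutions_def by (auto simp: x y_step) (auto simp: x_def)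
    moreover have "z = (\<lambda>r\<in>{..<g}. x (Suc r))"
    proof (rule extensionalityI[of _ "{..<g}"])
      fix r assume "r \<in> {..<g}"
      then show "z r = (\<lambda>r\<in>{..<g}. x (Suc r)) r"
        using gn by (simp add: x_def y_def)
    qed (use z in \<open>auto simp: PiE_iff\<close>)
    ultimately show "z \<in> (\<lambda>x. \<lambda>r\<in>{..<g}. x (Suc r)) ` recurrence_solutions" by blast
  qed
qed

lemma product_equations_iff_recurrence:
  assumes x: "x \<in> {1..n} \<rightarrow>\<^sub>E UNIV - {0 :: 'a}"
  shows "(\<exists>b. b \<noteq> 0 \<and> (\<forall>j<n. (\<Prod>l<k. x (Suc ((j + l) mod n))) = b * M j)) \<longleftrightarrow>
    x \<in> recurrence_solutions"
proof -
  define X where "X j = x (Suc (j mod n))" for j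
  have Xnz: "X j \<noteq> 0" for j using x n by (auto simp: X_def PiE_iff Suc_le_eq)
  have step: "(\<Prod>l<k. X (Suc j + l)) * X j = (\<Prod>l<k. X (j + l)) * X (j + k)" for j
    by (rule prod_consecutive_shift)
  have rec: "x \<in> recurrence_solutions \<longleftrightarrow> (\<forall>j. X (j + k) = X j * (M (Suc j) / M j))"
    using x by (simp add: recurrence_solutions_def X_def)
  show ?thesis
  proof
    assume "\<exists>b. b \<noteq> 0 \<and> (\<forall>j<n. (\<Prod>l<k. x (Suc ((j + l) mod n))) = b * M j)"
    then obtain b where b: "b \<noteq> 0" "\<And>j. j < n \<Longrightarrow> (\<Prod>l<k. X (j + l)) = b * M j"
      by (auto simp: X_def)
    have "M (j mod n) = M j" for j by (rule periodic_mod) (rule per)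
    moreover have "(\<Prod>l<k. X (j mod n + l)) = (\<Prod>l<k. X (j + l))" for j
      by (simp add: X_def mod_add_left_eq)
    ultimately have "(\<Prod>l<k. X (j + l)) = b * M j" for j
      using b(2)[of "j mod n"] n by simp
    then have "b * M (Suc j) * X j = b * M j * X (j + k)" for j using step[of j] by metis
    then have "M (Suc j) * X j = M j * X (j + k)" for j using b(1) by (simp add: mult.assoc)
    then show "x \<in> recurrence_solutions" unfolding rec using nz by (simp add: field_simps)
  next
    assume "x \<in> recurrence_solutions"
    then have r: "X (j + k) = X j * (M (Suc j) / M j)" for j using rec by blast
    \<comment> \<open>The equation at \<open>j = 0\<close> forces this value.\<close>
    define b where "b = (\<Prod>l<k. X l) / M 0"
    have "(\<Prod>l<k. X (j + l)) = b * M j" for j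
    proof (induction j)
      case 0 show ?case using nz by (simp add: b_def)
    next
      case (Suc j)
      have "(\<Prod>l<k. X (Suc j + l)) * X j = (b * M (Suc j)) * X j"
        unfolding step Suc r using nz[of j] by (simp add: field_simps)
      then show ?case using Xnz[of j] by simp
    qed
    moreover have "b \<noteq> 0" using Xnz nz by (simp add: b_def)
    ultimately show "\<exists>b. b \<noteq> 0 \<and> (\<forall>j<n. (\<Prod>l<k. x (Suc ((j + l) mod n))) = b * M j)"
      unfolding X_def by blast
  qed
qed

end

lemma card_product_equations:
  fixes M :: "nat \<Rightarrow> 'a::{field, finite}"
  assumes "n > 0" "g = gcd k n" "\<And>j. M (j + n) = M j" "\<And>j. M j \<noteq> 0"
    and "\<And>r. Suc r < g \<Longrightarrow> (\<Prod>t<n div g. M (Suc r + t * g)) = (\<Prod>t<n div g. M (r + t * g))"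
  shows "card {x \<in> {1..n} \<rightarrow>\<^sub>E UNIV - {0}.
      \<exists>b. b \<noteq> 0 \<and> (\<forall>j<n. (\<Prod>l<k. x (Suc ((j + l) mod n))) = b * M j)} = (CARD('a) - 1) ^ g"
proof -
  have "{x \<in> {1..n} \<rightarrow>\<^sub>E UNIV - {0}.
      \<exists>b. b \<noteq> 0 \<and> (\<forall>j<n. (\<Prod>l<k. x (Suc ((j + l) mod n))) = b * M j)} = recurrence_solutions k n M"
    using product_equations_iff_recurrence[OF assms]
    by (auto simp: recurrence_solutions_def[OF assms])
  then show ?thesis
    using bij_betw_same_card[OF bij_betw_recurrence_solutions[OF assms]]
    by (simp add: card_funcsetE card_Diff_singleton)
qed

section \<open>Configurations up to scaling\<close>

definition gl_mats :: "nat \<Rightarrow> 'a::field mat set" where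
  "gl_mats k = {A \<in> carrier_mat k k. det A \<noteq> 0}"

definition const_configs :: "nat \<Rightarrow> nat \<Rightarrow> (nat \<Rightarrow> 'a::field vec) set" where
  "const_configs k n = {V \<in> {1..n} \<rightarrow>\<^sub>E carrier_vec k.
     \<exists>b. b \<noteq> 0 \<and> (\<forall>i\<in>{1..n}. window_det k n V i = b)}"

lemma mult_mat_vec_cancel:
  fixes A B :: "'a::field mat"
  assumes "A \<in> carrier_mat k k" "B \<in> carrier_mat k k" "B * A = 1\<^sub>m k" "v \<in> carrier_vec k"
  shows "B *\<^sub>v (A *\<^sub>v v) = v"
  using assms assoc_mult_mat_vec[of B k k A k v] one_mult_mat_vec[of v k] by simp

text \<open>Column \<open>c\<close> of \<open>A\<close> is the image of the \<open>c\<close>-th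
  standard basis vector, so \<open>A\<close> can be read off the first \<open>k\<close> vectors of
  the image; hence the action is free.\<close>

lemma bij_betw_const_configs:
  assumes n: "k \<le> n" "n > 0"
  shows "bij_betw (\<lambda>(A, V). \<lambda>i\<in>{1..n}. A *\<^sub>v V i)
    (gl_mats k \<times> normal_configs k n) (const_configs k n :: (nat \<Rightarrow> 'a::field vec) set)"
proof (intro bij_betw_imageI inj_onI equalityI subsetI)
  fix x y :: "'a mat \<times> (nat \<Rightarrow> 'a vec)"
  assume x: "x \<in> gl_mats k \<times> normal_configs k n" and y: "y \<in> gl_mats k \<times> normal_configs k n"
    and eq: "(case x of (A, V) \<Rightarrow> \<lambda>i\<in>{1..n}. A *\<^sub>v V i) = (case y of (A, V) \<Rightarrow> \<lambda>i\<in>{1..n}. A *\<^sub>v V i)"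
  obtain A V where x': "x = (A, V)" by (cases x)
  obtain B W where y': "y = (B, W)" by (cases y)
  have A: "A \<in> carrier_mat k k" "det A \<noteq> 0" and V: "V \<in> normal_configs k n"
    and B: "B \<in> carrier_mat k k" and W: "W \<in> normal_configs k n"
    using x y by (auto simp: x' y' gl_mats_def)
  have eq': "A *\<^sub>v V i = B *\<^sub>v W i" if "i \<in> {1..n}" for i
    using fun_cong[OF eq, of i] that by (simp add: x' y')
  have "A = B"
  proof (rule mat_col_eqI)
    fix c assume "c < dim_col B"
    then have c: "c < k" using B by simp
    have "col A c = A *\<^sub>v V (Suc c)" "col B c = B *\<^sub>v W (Suc c)"
      using A B V W c by (auto simp: normal_configs_def intro!: eq_vecI)
    then show "col A c = col B c" using eq'[of "Suc c"] c n by simp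
  qed (use A B in auto)
  obtain A' where A': "A' \<in> carrier_mat k k" "A' * A = 1\<^sub>m k"
    using mat_inverse_exists[OF A] by blast
  have "V i = W i" if i: "i \<in> {1..n}" for i
  proof -
    have "V i \<in> carrier_vec k" "W i \<in> carrier_vec k"
      using V W i by (auto simp: normal_configs_def)
    then show ?thesis
      using eq'[OF i] mult_mat_vec_cancel[OF A(1) A'] \<open>A = B\<close> by metis
  qed
  then have "V = W"
    using V W by (intro PiE_ext[of V "{1..n}" _ W]) (auto simp: normal_configs_def)
  then show "x = y" using \<open>A = B\<close> by (simp add: x' y')
next
  fix W :: "nat \<Rightarrow> 'a vec"
  assume "W \<in> (\<lambda>(A, V). \<lambda>i\<in>{1..n}. A *\<^sub>v V i) ` (gl_mats k \<times> normal_configs k n)"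
  then obtain A V where W: "W = (\<lambda>i\<in>{1..n}. A *\<^sub>v V i)" and A: "A \<in> carrier_mat k k" "det A \<noteq> 0"
    and V: "V \<in> normal_configs k n" by (auto simp: gl_mats_def)
  have Vc: "V i \<in> carrier_vec k" if "i \<in> {1..n}" for i
    using V that by (auto simp: normal_configs_def)
  have "window_det k n W i = det A" if "i \<in> {1..n}" for i
    unfolding W using V that n A Vc by (subst window_det_mult_mat_vec) (auto simp: normal_configs_def)
  moreover have "W \<in> {1..n} \<rightarrow>\<^sub>E carrier_vec k" unfolding W using A Vc by auto
  ultimately show "W \<in> const_configs k n" using A by (auto simp: const_configs_def)
next
  fix W :: "nat \<Rightarrow> 'a vec"
  assume W: "W \<in> const_configs k n"
  then obtain b where b: "b \<noteq> 0" "\<And>i. i \<in> {1..n} \<Longrightarrow> window_det k n W i = b"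
    by (auto simp: const_configs_def)
  have Wc: "W i \<in> carrier_vec k" if "i \<in> {1..n}" for i
    using W that by (auto simp: const_configs_def)
  obtain A B where A: "A \<in> carrier_mat k k" "B \<in> carrier_mat k k" "B * A = 1\<^sub>m k" "A * B = 1\<^sub>m k"
    "det A = b" "(\<lambda>i\<in>{1..n}. B *\<^sub>v W i) \<in> normal_configs k n"
    using normalise_config[OF n Wc b] by blast
  have "W = (\<lambda>i\<in>{1..n}. A *\<^sub>v (\<lambda>i\<in>{1..n}. B *\<^sub>v W i) i)"
  proof (rule extensionalityI[of _ "{1..n}"])
    fix i assume "i \<in> {1..n}"
    then show "W i = (\<lambda>i\<in>{1..n}. A *\<^sub>v (\<lambda>i\<in>{1..n}. B *\<^sub>v W i) i) i"
      using mult_mat_vec_cancel[OF A(2,1,4) Wc] by simp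
  qed (use W in \<open>auto simp: const_configs_def PiE_iff\<close>)
  moreover have "(A, \<lambda>i\<in>{1..n}. B *\<^sub>v W i) \<in> gl_mats k \<times> normal_configs k n"
    using A b by (auto simp: gl_mats_def)
  ultimately show "W \<in> (\<lambda>(A, V). \<lambda>i\<in>{1..n}. A *\<^sub>v V i) ` (gl_mats k \<times> normal_configs k n)"
    by (intro image_eqI[of _ _ "(A, \<lambda>i\<in>{1..n}. B *\<^sub>v W i)"]) auto
qed

definition scalings :: "nat \<Rightarrow> (nat \<Rightarrow> 'a::field) set" where
  "scalings n = {1..n} \<rightarrow>\<^sub>E UNIV - {0}"

definition scale_config :: "nat \<Rightarrow> (nat \<Rightarrow> 'a::field) \<Rightarrow> (nat \<Rightarrow> 'a vec) \<Rightarrow> nat \<Rightarrow> 'a vec" where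
  "scale_config n a V = (\<lambda>i\<in>{1..n}. a i \<cdot>\<^sub>v V i)"

lemma cyc_range: "n > 0 \<Longrightarrow> cyc n i \<in> {1..n}"
  by (simp add: cyc_def Suc_le_eq)

lemma cyc_Suc: "cyc n (Suc j) = Suc (j mod n)"
  by (simp add: cyc_def)

lemma window_det_scale:
  assumes "n > 0" "\<And>i. i \<in> {1..n} \<Longrightarrow> V i \<in> carrier_vec k"
  shows "window_det k n (scale_config n a V) i = (\<Prod>l<k. a (cyc n (i + l))) * window_det k n V i"
proof -
  have "lift_ext k n (scale_config n a V) m = a (cyc n m) \<cdot>\<^sub>v lift_ext k n V m" for m
    using cyc_range[OF assms(1), of m]
    by (simp add: lift_ext_def scale_config_def smult_smult_assoc mult.commute)
  then have "window_det k n (scale_config n a V) i =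
      col_det k (\<lambda>l. a (cyc n (i + l)) \<cdot>\<^sub>v lift_ext k n V (i + l))"
    unfolding window_det_def col_det_mat_of_cols by simp
  also have "\<dots> = (\<Prod>l<k. a (cyc n (i + l))) * col_det k (\<lambda>l. lift_ext k n V (i + l))"
    by (rule col_det_smult) (use assms cyc_range in \<open>auto simp: lift_ext_def\<close>)
  finally show ?thesis unfolding window_det_def col_det_mat_of_cols .
qed

text \<open>For \<open>g = 1\<close> the range of \<open>i\<close> is empty, which lets both cases
  of the theorem share one count.\<close>

definition class_balanced :: "nat \<Rightarrow> nat \<Rightarrow> (nat \<Rightarrow> 'a::field) \<Rightarrow> bool" where
  "class_balanced g n d \<longleftrightarrow>
    (\<forall>i\<in>{1..g - 1}. (\<Prod>t<n div g. d (i + t * g)) = (\<Prod>t<n div g. d (i + 1 + t * g)))"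

text \<open>A scaling multiplies all class products by the same factor. Hence the condition in
  \<open>Ck_star\<close> does not depend on the lift.\<close>

lemma class_balanced_mult:
  assumes a: "\<And>i. i \<in> {1..n} \<Longrightarrow> d' i = (\<Prod>l<k. a (cyc n (i + l))) * d i"
    and n: "n > 0" and g: "g = gcd k n" and d: "class_balanced g n d"
  shows "class_balanced g n d'"
  unfolding class_balanced_def
proof
  fix i assume i: "i \<in> {1..g - 1}"
  then obtain j where j: "i = Suc j" "Suc j < g" by (cases i) auto
  \<comment> \<open>Assumption \<open>a\<close> covers indices in \<open>{1..n}\<close> only, and
    the class products never leave this range.\<close>
  have idx: "j' + t * g < n" if "j' < g" "t < n div g" for j' t
  proof -
    have "j' + t * g < (t + 1) * g" using that by simp
    also have "\<dots> \<le> n div g * g" using that by (intro mult_right_mono) auto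
    also have "\<dots> = n" using g by simp
    finally show ?thesis .
  qed
  let ?F = "\<lambda>j. a (Suc (j mod n))"
  have split: "(\<Prod>t<n div g. d' (Suc j' + t * g)) =
      (\<Prod>t<n div g. \<Prod>l<k. ?F (j' + t * g + l)) * (\<Prod>t<n div g. d (Suc j' + t * g))"
    if "j' < g" for j'
    unfolding prod.distrib[symmetric]
  proof (rule prod.cong[OF refl])
    fix t assume "t \<in> {..<n div g}"
    then have "Suc j' + t * g \<in> {1..n}" using idx[OF that, of t] by simp
    then show "d' (Suc j' + t * g) = (\<Prod>l<k. ?F (j' + t * g + l)) * d (Suc j' + t * g)"
      using a by (simp add: cyc_Suc)
  qed
  have "(\<Prod>t<n div g. \<Prod>l<k. ?F (Suc j + t * g + l)) = (\<Prod>t<n div g. \<Prod>l<k. ?F (j + t * g + l))"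
    by (rule prod_class_of_consecutive[of ?F n g k]) (use g in auto)
  moreover have "(\<Prod>t<n div g. d (Suc j + t * g)) = (\<Prod>t<n div g. d (Suc (Suc j) + t * g))"
    using bspec[OF d[unfolded class_balanced_def], of "Suc j"] i j by simp
  ultimately have "(\<Prod>t<n div g. d' (Suc j + t * g)) = (\<Prod>t<n div g. d' (Suc (Suc j) + t * g))"
    using split[of j] split[of "Suc j"] j by simp
  then show "(\<Prod>t<n div g. d' (i + t * g)) = (\<Prod>t<n div g. d' (i + 1 + t * g))"
    using j by simp
qed

definition star_configs :: "nat \<Rightarrow> nat \<Rightarrow> (nat \<Rightarrow> 'a::field vec) set" where
  "star_configs k n = {V \<in> {1..n} \<rightarrow>\<^sub>E carrier_vec k.
     (\<forall>i\<in>{1..n}. window_det k n V i \<noteq> 0) \<and> class_balanced (gcd k n) n (window_det k n V)}"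

text \<open>These are the scalings by which a configuration with window determinants
  \<open>d\<close> arises from a constant one: dividing by \<open>a\<close> leaves the constant
  \<open>inverse b\<close>.\<close>

definition solving_scalings :: "nat \<Rightarrow> nat \<Rightarrow> (nat \<Rightarrow> 'a::field) \<Rightarrow> (nat \<Rightarrow> 'a) set" where
  "solving_scalings k n d = {a \<in> scalings n.
     \<exists>b. b \<noteq> 0 \<and> (\<forall>i\<in>{1..n}. (\<Prod>l<k. a (cyc n (i + l))) = b * d i)}"

lemma card_solving_scalings:
  fixes d :: "nat \<Rightarrow> 'a::{field, finite}"
  assumes n: "n > 0" and d: "\<And>i. i \<in> {1..n} \<Longrightarrow> d i \<noteq> 0" and bal: "class_balanced (gcd k n) n d"
  shows "card (solving_scalings k n d) = (CARD('a) - 1) ^ gcd k n"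
proof -
  let ?g = "gcd k n"
  define M where "M j = d (Suc (j mod n))" for j
  have "solving_scalings k n d = {x \<in> {1..n} \<rightarrow>\<^sub>E UNIV - {0}.
      \<exists>b. b \<noteq> 0 \<and> (\<forall>j<n. (\<Prod>l<k. x (Suc ((j + l) mod n))) = b * M j)}"
  proof -
    have "(\<forall>i\<in>{1..n}. P i) \<longleftrightarrow> (\<forall>j<n. P (Suc j))" for P
      by (metis Suc_le_eq atLeastAtMost_iff gr0_conv_Suc One_nat_def)
    then show ?thesis
      unfolding solving_scalings_def scalings_def by (simp add: cyc_Suc M_def)
  qed
  moreover have "(\<Prod>t<n div ?g. M (Suc r + t * ?g)) = (\<Prod>t<n div ?g. M (r + t * ?g))"
    if r: "Suc r < ?g" for r
  proof -
    have M: "M (j' + t * ?g) = d (Suc j' + t * ?g)" if "j' < ?g" "t < n div ?g" for j' t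
    proof -
      have "j' + t * ?g < (t + 1) * ?g" using that by simp
      also have "\<dots> \<le> n div ?g * ?g" using that by (intro mult_right_mono) auto
      also have "\<dots> = n" by simp
      finally show ?thesis by (simp add: M_def)
    qed
    have prod_M: "(\<Prod>t<n div ?g. M (j' + t * ?g)) = (\<Prod>t<n div ?g. d (Suc j' + t * ?g))" if "j' < ?g" for j'
      by (rule prod.cong) (use that M in auto)
    show ?thesis
      using bspec[OF bal[unfolded class_balanced_def], of "Suc r"] r prod_M[of r] prod_M[of "Suc r"]
      by simp
  qed
  moreover have "M j \<noteq> 0" "M (j + n) = M j" for j
    using d[of "Suc (j mod n)"] n by (auto simp: M_def Suc_le_eq)
  ultimately show ?thesis using card_product_equations[OF n refl, of M] by simp
qed

text \<open>Double counting of pairs. Keeping \<open>a\<close> in the image makes the map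
  invertible, and all fibres over the configurations \<open>W\<close> have the same size.\<close>

lemma bij_betw_scale_config:
  assumes n: "n > 0"
  shows "bij_betw (\<lambda>(a, V). (scale_config n a V, a)) (scalings n \<times> const_configs k n)
    (SIGMA W:(star_configs k n :: (nat \<Rightarrow> 'a::field vec) set). solving_scalings k n (window_det k n W))"
proof (rule bij_betw_byWitness[where f' = "\<lambda>(W, a). (a, scale_config n (\<lambda>i. inverse (a i)) W)"])
  have inv: "scale_config n (\<lambda>i. inverse (a i)) (scale_config n a V) = V"
    "scale_config n a (scale_config n (\<lambda>i. inverse (a i)) V) = V"
    if "a \<in> scalings n" "V \<in> {1..n} \<rightarrow>\<^sub>E carrier_vec k" for a :: "nat \<Rightarrow> 'a" and V :: "nat \<Rightarrow> 'a vec"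
    using that by (auto simp: scale_config_def scalings_def smult_smult_assoc PiE_iff
        intro!: extensionalityI[of _ "{1..n}"])
  show "\<forall>x\<in>scalings n \<times> (const_configs k n :: (nat \<Rightarrow> 'a vec) set). (case case x of (a, V) \<Rightarrow> (scale_config n a V, a) of
      (W, a) \<Rightarrow> (a, scale_config n (\<lambda>i. inverse (a i)) W)) = x"
    using inv by (auto simp: const_configs_def simp del: One_nat_def)
  show "\<forall>y\<in>SIGMA W:(star_configs k n :: (nat \<Rightarrow> 'a vec) set). solving_scalings k n (window_det k n W).
      (case case y of (W, a) \<Rightarrow> (a, scale_config n (\<lambda>i. inverse (a i)) W) of
      (a, V) \<Rightarrow> (scale_config n a V, a)) = y"
    using inv by (auto simp: star_configs_def solving_scalings_def simp del: One_nat_def)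
  show "(\<lambda>(a, V). (scale_config n a V, a)) ` (scalings n \<times> const_configs k n) \<subseteq>
      (SIGMA W:(star_configs k n :: (nat \<Rightarrow> 'a vec) set). solving_scalings k n (window_det k n W))"
  proof clarify
    fix a :: "nat \<Rightarrow> 'a" and V :: "nat \<Rightarrow> 'a vec"
    assume a: "a \<in> scalings n" and "V \<in> const_configs k n"
    then obtain b where V: "V \<in> {1..n} \<rightarrow>\<^sub>E carrier_vec k" and b: "b \<noteq> 0"
      "\<And>i. i \<in> {1..n} \<Longrightarrow> window_det k n V i = b" by (auto simp: const_configs_def)
    have a_nz: "a (cyc n i) \<noteq> 0" for i using a cyc_range[OF n, of i] by (auto simp: scalings_def)
    have W: "window_det k n (scale_config n a V) i = (\<Prod>l<k. a (cyc n (i + l))) * b"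
      if "i \<in> {1..n}" for i
      using V n b that by (subst window_det_scale) auto
    have "scale_config n a V \<in> star_configs k n"
      unfolding star_configs_def
    proof (intro CollectI conjI ballI)
      show "scale_config n a V \<in> {1..n} \<rightarrow>\<^sub>E carrier_vec k"
        using V by (auto simp: scale_config_def)
      show "window_det k n (scale_config n a V) i \<noteq> 0" if "i \<in> {1..n}" for i
        using W[OF that] b a_nz by simp
      show "class_balanced (gcd k n) n (window_det k n (scale_config n a V))"
        by (rule class_balanced_mult[where d = "\<lambda>_. b", OF W n refl]) (simp_all add: class_balanced_def)
    qed
    moreover have "a \<in> solving_scalings k n (window_det k n (scale_config n a V))"
      unfolding solving_scalings_def using a b(1)
      by (auto simp: W intro!: exI[of _ "inverse b"])
    ultimately show "scale_config n a V \<in> star_configs k n \<and>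
        a \<in> solving_scalings k n (window_det k n (scale_config n a V))" ..
  qed
  show "(\<lambda>(W, a). (a, scale_config n (\<lambda>i. inverse (a i)) W)) `
      (SIGMA W:(star_configs k n :: (nat \<Rightarrow> 'a vec) set). solving_scalings k n (window_det k n W)) \<subseteq>
      scalings n \<times> const_configs k n"
  proof clarify
    fix W :: "nat \<Rightarrow> 'a vec" and a :: "nat \<Rightarrow> 'a"
    assume W: "W \<in> star_configs k n" and "a \<in> solving_scalings k n (window_det k n W)"
    then obtain b where a: "a \<in> scalings n" and b: "b \<noteq> 0"
      "\<And>i. i \<in> {1..n} \<Longrightarrow> (\<Prod>l<k. a (cyc n (i + l))) = b * window_det k n W i"
      by (auto simp: solving_scalings_def)
    have Wc: "W \<in> {1..n} \<rightarrow>\<^sub>E carrier_vec k" using W by (simp add: star_configs_def)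
    have "window_det k n (scale_config n (\<lambda>i. inverse (a i)) W) i = inverse b" if i: "i \<in> {1..n}" for i
    proof -
      have "window_det k n (scale_config n (\<lambda>i. inverse (a i)) W) i =
          inverse (\<Prod>l<k. a (cyc n (i + l))) * window_det k n W i"
        using Wc n by (subst window_det_scale) (auto simp: comp_def prod_inversef[symmetric])
      also have "\<dots> = inverse (b * window_det k n W i) * window_det k n W i"
        by (simp only: b(2)[OF i])
      also have "\<dots> = inverse b" using W i by (simp add: star_configs_def)
      finally show ?thesis .
    qed
    moreover have "scale_config n (\<lambda>i. inverse (a i)) W \<in> {1..n} \<rightarrow>\<^sub>E carrier_vec k"
      using Wc by (auto simp: scale_config_def)
    ultimately have "scale_config n (\<lambda>i. inverse (a i)) W \<in> const_configs k n"
      using b(1) unfolding const_configs_def by (auto intro!: exI[of _ "inverse b"])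
    with a show "a \<in> scalings n \<and> scale_config n (\<lambda>i. inverse (a i)) W \<in> const_configs k n" ..
  qed
qed

lemma finite_carrier_vec: "finite (carrier_vec k :: 'a::finite vec set)"
proof -
  have "(carrier_vec k :: 'a vec set) \<subseteq> vec_of_list ` {xs. set xs \<subseteq> UNIV \<and> length xs = k}"
  proof
    fix v :: "'a vec" assume "v \<in> carrier_vec k"
    then show "v \<in> vec_of_list ` {xs. set xs \<subseteq> UNIV \<and> length xs = k}"
      by (intro image_eqI[of _ _ "list_of_vec v"]) (auto simp: vec_list)
  qed
  then show ?thesis by (rule finite_subset) (intro finite_imageI finite_lists_length_eq, simp)
qed

lemma card_scalings: "card (scalings n :: (nat \<Rightarrow> 'a::{field, finite}) set) = (CARD('a) - 1) ^ n"
  by (simp add: scalings_def card_funcsetE card_Diff_singleton)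

lemma card_const_configs_star_configs:
  assumes "n > 0"
  shows "(CARD('a) - 1) ^ n * card (const_configs k n :: (nat \<Rightarrow> 'a::{field, finite} vec) set) =
    (CARD('a) - 1) ^ gcd k n * card (star_configs k n :: (nat \<Rightarrow> 'a vec) set)"
proof -
  have fin: "finite (star_configs k n :: (nat \<Rightarrow> 'a vec) set)"
    by (rule finite_subset[OF _ finite_PiE[of "{1..n}" "\<lambda>_. carrier_vec k"]])
      (auto simp: star_configs_def finite_carrier_vec)
  have fin2: "finite (solving_scalings k n d)" for d :: "nat \<Rightarrow> 'a"
    by (rule finite_subset[OF _ finite_PiE[of "{1..n}" "\<lambda>_. UNIV - {0}"]])
      (auto simp: solving_scalings_def scalings_def)
  have "card ((scalings n :: (nat \<Rightarrow> 'a) set) \<times> (const_configs k n :: (nat \<Rightarrow> 'a vec) set)) =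
      (\<Sum>W\<in>(star_configs k n :: (nat \<Rightarrow> 'a vec) set). card (solving_scalings k n (window_det k n W)))"
    using bij_betw_same_card[OF bij_betw_scale_config[OF assms, of k, where 'a = 'a]] fin fin2
    by (simp add: card_SigmaI)
  also have "\<dots> = (\<Sum>W\<in>(star_configs k n :: (nat \<Rightarrow> 'a vec) set). (CARD('a) - 1) ^ gcd k n)"
    by (intro sum.cong refl card_solving_scalings[OF assms]) (auto simp: star_configs_def)
  finally show ?thesis by (simp add: card_cartesian_product card_scalings mult.commute)
qed

section \<open>Projective configurations\<close>

lemma equiv_proj_rel: "equiv (carrier_vec k - {0\<^sub>v k}) (proj_rel k :: ('a::field vec \<times> 'a vec) set)"
proof (intro equivI refl_onI symI transI)
  show "(proj_rel k :: ('a vec \<times> 'a vec) set) \<subseteq> (carrier_vec k - {0\<^sub>v k}) \<times> (carrier_vec k - {0\<^sub>v k})"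
    by (auto simp: proj_rel_def)
  fix x y z :: "'a vec"
  show "x \<in> carrier_vec k - {0\<^sub>v k} \<Longrightarrow> (x, x) \<in> proj_rel k"
    by (auto simp: proj_rel_def intro!: exI[of _ 1])
  show "(y, x) \<in> proj_rel k" if xy: "(x, y) \<in> proj_rel k"
  proof -
    obtain c where "c \<noteq> 0" "y = c \<cdot>\<^sub>v x" using xy by (auto simp: proj_rel_def)
    then have "x = inverse c \<cdot>\<^sub>v y" by (simp add: smult_smult_assoc)
    moreover have "inverse c \<noteq> 0" using \<open>c \<noteq> 0\<close> by simp
    ultimately show ?thesis
      using xy unfolding proj_rel_def mem_Collect_eq case_prod_conv by blast
  qed
  show "(x, z) \<in> proj_rel k" if xy: "(x, y) \<in> proj_rel k" and yz: "(y, z) \<in> proj_rel k"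
  proof -
    obtain c d where "c \<noteq> 0" "y = c \<cdot>\<^sub>v x" "d \<noteq> 0" "z = d \<cdot>\<^sub>v y"
      using xy yz by (auto simp: proj_rel_def)
    then have "z = (d * c) \<cdot>\<^sub>v x" "d * c \<noteq> 0" by (simp_all add: smult_smult_assoc)
    then show ?thesis
      using xy yz unfolding proj_rel_def mem_Collect_eq case_prod_conv by blast
  qed
qed

lemma proj_space_memD:
  assumes "p \<in> proj_space k" "x \<in> p"
  shows "x \<in> carrier_vec k" "x \<noteq> 0\<^sub>v k" "p = {c \<cdot>\<^sub>v x |c. c \<noteq> 0}"
proof -
  have p: "p \<in> (carrier_vec k - {0\<^sub>v k}) // proj_rel k" using assms by (simp add: proj_space_def)
  then have "x \<in> carrier_vec k - {0\<^sub>v k}"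
    using assms(2) in_quotient_imp_subset[OF equiv_proj_rel] by blast
  then show x: "x \<in> carrier_vec k" "x \<noteq> 0\<^sub>v k" by auto
  have "p = proj_rel k `` {x}"
    using p assms(2) by (metis equiv_proj_rel Image_singleton_iff equiv_class_eq_iff quotientE)
  also have "\<dots> = {c \<cdot>\<^sub>v x |c. c \<noteq> 0}"
  proof -
    have "c \<cdot>\<^sub>v x \<noteq> 0\<^sub>v k" if "c \<noteq> 0" for c
    proof
      assume "c \<cdot>\<^sub>v x = 0\<^sub>v k"
      then have "inverse c \<cdot>\<^sub>v (c \<cdot>\<^sub>v x) = 0\<^sub>v k" by (auto intro!: eq_vecI)
      then show False using that x by (simp add: smult_smult_assoc)
    qed
    then show ?thesis using x by (auto simp: proj_rel_def)
  qed
  finally show "p = {c \<cdot>\<^sub>v x |c. c \<noteq> 0}" .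
qed

lemma card_proj_point:
  fixes p :: "'a::{field, finite} vec set"
  assumes "p \<in> proj_space k"
  shows "card p = CARD('a) - 1"
proof -
  obtain x where "x \<in> p"
    using assms in_quotient_imp_non_empty[OF equiv_proj_rel] by (auto simp: proj_space_def)
  note x = proj_space_memD[OF assms this]
  have "inj_on (\<lambda>c. c \<cdot>\<^sub>v x) (UNIV - {0})"
  proof (rule inj_onI)
    fix c d assume eq: "c \<cdot>\<^sub>v x = d \<cdot>\<^sub>v x"
    obtain r where r: "r < k" "x $ r \<noteq> 0" using x(1,2) by (metis eq_vecI carrier_vecD index_zero_vec)
    have "c * x $ r = d * x $ r" using arg_cong[OF eq, of "\<lambda>v. v $ r"] r x(1) by simp
    then show "c = d" using r by simp
  qed
  moreover have "p = (\<lambda>c. c \<cdot>\<^sub>v x) ` (UNIV - {0})" using x(3) by auto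
  ultimately show ?thesis by (simp add: card_image card_Diff_singleton)
qed

lemma proj_point_scaling:
  assumes "\<And>l. l \<in> I \<Longrightarrow> p l \<in> proj_space k" "\<And>l. l \<in> I \<Longrightarrow> X l \<in> p l" "\<And>l. l \<in> I \<Longrightarrow> Y l \<in> p l"
  obtains c where "\<And>l. l \<in> I \<Longrightarrow> c l \<noteq> 0" "\<And>l. l \<in> I \<Longrightarrow> Y l = c l \<cdot>\<^sub>v X l"
proof -
  have "\<forall>l\<in>I. \<exists>c. c \<noteq> 0 \<and> Y l = c \<cdot>\<^sub>v X l"
    using proj_space_memD(3) assms by blast
  then show thesis using that by (metis (no_types))
qed

text \<open>Two choices of representatives differ by nonzero scalars, which change the determinant
  by a nonzero factor.\<close>

lemma proj_indep_iff_col_det: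
  assumes p: "\<And>l. l < k \<Longrightarrow> p l \<in> proj_space k" and Y: "\<And>l. l < k \<Longrightarrow> Y l \<in> p l"
  shows "proj_indep k k p \<longleftrightarrow> col_det k Y \<noteq> 0"
proof
  assume "proj_indep k k p"
  then obtain X where X: "\<And>l. l < k \<Longrightarrow> X l \<in> p l" "lin_indep_family k k X"
    by (auto simp: proj_indep_def)
  have Xc: "X l \<in> carrier_vec k" if "l < k" for l
    using proj_space_memD(1)[OF p X(1)] that by blast
  obtain c where c: "\<And>l. l \<in> {..<k} \<Longrightarrow> c l \<noteq> 0" "\<And>l. l \<in> {..<k} \<Longrightarrow> Y l = c l \<cdot>\<^sub>v X l"
    using proj_point_scaling[of "{..<k}" p k X Y] p X(1) Y by auto
  have "col_det k Y = col_det k (\<lambda>l. c l \<cdot>\<^sub>v X l)"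
    by (rule col_det_cong) (use c in auto)
  also have "\<dots> = (\<Prod>l<k. c l) * col_det k X" by (rule col_det_smult) (rule Xc)
  finally show "col_det k Y \<noteq> 0"
    using c lin_indep_family_iff_col_det[of k X] Xc X(2) by simp
next
  assume "col_det k Y \<noteq> 0"
  moreover have "Y l \<in> carrier_vec k" if "l < k" for l
    using proj_space_memD(1)[OF p Y] that by blast
  ultimately have "lin_indep_family k k Y" by (simp add: lin_indep_family_iff_col_det)
  then show "proj_indep k k p" using Y by (auto simp: proj_indep_def)
qed

lemma window_det_cong:
  assumes "n > 0" "\<And>i. i \<in> {1..n} \<Longrightarrow> V i = V' i"
  shows "window_det k n V = window_det k n V'"
  unfolding window_det_def lift_ext_def using assms(2)[OF cyc_range[OF assms(1)]] by simp

context
  fixes k n :: nat and v :: "nat \<Rightarrow> 'a::field vec set" and V :: "nat \<Rightarrow> 'a vec"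
  assumes n: "n > 0" and v: "v \<in> {1..n} \<rightarrow>\<^sub>E proj_space k" and V: "V \<in> Pi\<^sub>E {1..n} v"
begin

lemma lift_carrier: "i \<in> {1..n} \<Longrightarrow> V i \<in> carrier_vec k"
  using v V proj_space_memD(1)[of "v i" k "V i"] by (auto simp: PiE_iff)

lemma Ck_iff_window_det: "v \<in> Ck k n \<longleftrightarrow> (\<forall>i\<in>{1..n}. window_det k n V i \<noteq> 0)"
proof -
  have "proj_indep k k (\<lambda>l. v (cyc n (i + l))) \<longleftrightarrow> window_det k n V i \<noteq> 0" for i
    unfolding window_det_def col_det_mat_of_cols
  proof (rule proj_indep_iff_col_det)
    fix l
    show vl: "v (cyc n (i + l)) \<in> proj_space k" using v cyc_range[OF n] by blast
    have "V (cyc n (i + l)) \<in> v (cyc n (i + l))" using V cyc_range[OF n] by blast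
    \<comment> \<open>The sign in \<open>lift_ext\<close> is a nonzero scalar and stays within the
      projective point.\<close>
    from proj_space_memD(3)[OF vl this] show "lift_ext k n V (i + l) \<in> v (cyc n (i + l))"
      unfolding lift_ext_def by (auto intro!: exI)
  qed
  then show ?thesis using v by (simp add: Ck_def)
qed

lemma Ck_star_iff_star_configs: "v \<in> Ck_star k n \<longleftrightarrow> V \<in> star_configs k n"
proof -
  have star: "v \<in> Ck_star k n \<longleftrightarrow>
      v \<in> Ck k n \<and> (\<exists>W. is_lift n v W \<and> class_balanced (gcd k n) n (window_det k n W))"
    by (simp add: Ck_star_def class_balanced_def Let_def)
  have "V \<in> {1..n} \<rightarrow>\<^sub>E carrier_vec k" using lift_carrier V by (auto simp: PiE_iff)
  then have configs: "V \<in> star_configs k n \<longleftrightarrow>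
      v \<in> Ck k n \<and> class_balanced (gcd k n) n (window_det k n V)"
    unfolding Ck_iff_window_det star_configs_def by simp
  have "class_balanced (gcd k n) n (window_det k n V)"
    if W: "is_lift n v W" and bal: "class_balanced (gcd k n) n (window_det k n W)" for W
  proof -
    have vi: "v i \<in> proj_space k" and Wi: "W i \<in> v i" and Vi: "V i \<in> v i" if "i \<in> {1..n}" for i
      using v V W that by (auto simp: is_lift_def PiE_iff)
    obtain a where a: "\<And>i. i \<in> {1..n} \<Longrightarrow> V i = a i \<cdot>\<^sub>v W i"
      using proj_point_scaling[of "{1..n}" v k W V, OF vi Wi Vi] by blast
    have "window_det k n V = window_det k n (scale_config n a W)"
      by (rule window_det_cong[OF n]) (use a in \<open>simp add: scale_config_def\<close>)
    moreover have "W i \<in> carrier_vec k" if "i \<in> {1..n}" for i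
      using proj_space_memD(1)[OF vi Wi] that by blast
    ultimately have "window_det k n V i = (\<Prod>l<k. a (cyc n (i + l))) * window_det k n W i" for i
      using window_det_scale[OF n, of W k a i] by simp
    then show ?thesis by (rule class_balanced_mult[OF _ n refl bal])
  qed
  moreover have "is_lift n v V" using V by (auto simp: is_lift_def)
  ultimately show ?thesis unfolding star configs by blast
qed

end

text \<open>If \<open>V i\<close> were zero, scaling it by 0 would change nothing and yet multiply
  the window determinant by 0.\<close>

lemma window_det_nonzero_imp_nonzero:
  assumes "k \<ge> 1" "i \<in> {1..n}" "\<And>i. i \<in> {1..n} \<Longrightarrow> V i \<in> carrier_vec k" "window_det k n V i \<noteq> 0"
  shows "V i \<noteq> 0\<^sub>v k"
proof
  assume "V i = 0\<^sub>v k"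
  let ?a = "\<lambda>j. if j = i then 0 else 1"
  have "scale_config n ?a V j = V j" if "j \<in> {1..n}" for j
    using that \<open>V i = 0\<^sub>v k\<close> by (auto simp: scale_config_def)
  then have "window_det k n V i = window_det k n (scale_config n ?a V) i"
    using window_det_cong[of n V "scale_config n ?a V" k] assms(2) by simp
  also have "\<dots> = (\<Prod>l<k. ?a (cyc n (i + l))) * window_det k n V i"
    using assms by (intro window_det_scale) auto
  also have "(\<Prod>l<k. ?a (cyc n (i + l))) = (0 :: 'a)"
    using assms(1,2) by (intro prod_zero) (auto simp: cyc_def intro!: bexI[of _ 0])
  finally show False using assms(4) by simp
qed

text \<open>Nonzero windows force nonzero vectors, so every configuration lies over a tuple of
  points; over a given tuple either all lifts qualify or none.\<close>

lemma star_configs_eq_UN: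
  assumes "k \<ge> 1" "n > 0"
  shows "star_configs k n = (\<Union>v\<in>Ck_star k n. Pi\<^sub>E {1..n} v)"
proof (intro equalityI subsetI)
  fix V :: "nat \<Rightarrow> 'a vec" assume V: "V \<in> star_configs k n"
  have Vi: "V i \<in> carrier_vec k - {0\<^sub>v k}" if "i \<in> {1..n}" for i
  proof -
    have "V i \<in> carrier_vec k" if "i \<in> {1..n}" for i
      using V that by (auto simp: star_configs_def)
    moreover have "window_det k n V i \<noteq> 0" using V that by (simp add: star_configs_def)
    ultimately show ?thesis using window_det_nonzero_imp_nonzero[OF assms(1) that] that by blast
  qed
  define v where "v = (\<lambda>i\<in>{1..n}. proj_rel k `` {V i})"
  have v: "v \<in> {1..n} \<rightarrow>\<^sub>E proj_space k"
    using Vi by (auto simp: v_def proj_space_def intro!: quotientI)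
  have "V \<in> Pi\<^sub>E {1..n} v"
    using V equiv_class_self[OF equiv_proj_rel Vi] by (auto simp: v_def star_configs_def PiE_iff)
  then show "V \<in> (\<Union>v\<in>Ck_star k n. Pi\<^sub>E {1..n} v)"
    using Ck_star_iff_star_configs[OF assms(2) v] V by blast
next
  fix V :: "nat \<Rightarrow> 'a vec" assume "V \<in> (\<Union>v\<in>Ck_star k n. Pi\<^sub>E {1..n} v)"
  then obtain v where v: "v \<in> Ck_star k n" "V \<in> Pi\<^sub>E {1..n} v" by blast
  moreover have "v \<in> {1..n} \<rightarrow>\<^sub>E proj_space k" using v by (simp add: Ck_star_def Ck_def)
  ultimately show "V \<in> star_configs k n" using Ck_star_iff_star_configs[OF assms(2)] by blast
qed

lemma finite_proj_space: "finite (proj_space k :: 'a::{field, finite} vec set set)"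
  unfolding proj_space_def
  by (rule finite_quotient) (auto simp: finite_carrier_vec proj_rel_def)

lemma card_star_configs:
  assumes "k \<ge> 1" "n > 0"
  shows "card (star_configs k n :: (nat \<Rightarrow> 'a::{field, finite} vec) set) =
    (CARD('a) - 1) ^ n * card (Ck_star k n :: (nat \<Rightarrow> 'a vec set) set)"
proof -
  let ?C = "Ck_star k n :: (nat \<Rightarrow> 'a vec set) set"
  have sub: "?C \<subseteq> {1..n} \<rightarrow>\<^sub>E proj_space k" by (auto simp: Ck_star_def Ck_def)
  have fin: "finite ?C"
    by (rule finite_subset[OF sub]) (intro finite_PiE, simp_all add: finite_proj_space)
  have point: "v i \<in> proj_space k" if "v \<in> ?C" "i \<in> {1..n}" for v i using sub that by blast
  have finp: "finite (v i)" if "v \<in> ?C" "i \<in> {1..n}" for v i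
    by (rule finite_subset[OF _ finite_carrier_vec[of k]]) (use proj_space_memD(1)[OF point[OF that]] in blast)
  have "card (\<Union>v\<in>?C. Pi\<^sub>E {1..n} v) = (\<Sum>v\<in>?C. card (Pi\<^sub>E {1..n} v))"
  proof (rule card_UN_disjoint[OF fin])
    show "\<forall>v\<in>?C. finite (Pi\<^sub>E {1..n} v)" using finp by (auto intro!: finite_PiE)
    show "\<forall>v\<in>?C. \<forall>v'\<in>?C. v \<noteq> v' \<longrightarrow> Pi\<^sub>E {1..n} v \<inter> Pi\<^sub>E {1..n} v' = {}"
    proof (intro ballI impI, rule ccontr)
      fix v v' assume vv': "v \<in> ?C" "v' \<in> ?C" "v \<noteq> v'" "Pi\<^sub>E {1..n} v \<inter> Pi\<^sub>E {1..n} v' \<noteq> {}"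
      then obtain V where V: "V \<in> Pi\<^sub>E {1..n} v" "V \<in> Pi\<^sub>E {1..n} v'" by blast
      have "v i = v' i" if "i \<in> {1..n}" for i
        using proj_space_memD(3)[OF point[OF vv'(1) that], of "V i"]
          proj_space_memD(3)[OF point[OF vv'(2) that], of "V i"] V that by (auto simp: PiE_iff)
      moreover have "v \<in> {1..n} \<rightarrow>\<^sub>E proj_space k" "v' \<in> {1..n} \<rightarrow>\<^sub>E proj_space k"
        using vv'(1,2) sub by blast+
      ultimately have "v = v'" by (intro PiE_ext)
      then show False using vv' by simp
    qed
  qed
  also have "\<dots> = (\<Sum>v\<in>?C. (CARD('a) - 1) ^ n)"
  proof (rule sum.cong[OF refl])
    fix v assume v: "v \<in> ?C"
    have "card (Pi\<^sub>E {1..n} v) = (\<Prod>i\<in>{1..n}. card (v i))" by (simp add: card_PiE)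
    also have "\<dots> = (\<Prod>i\<in>{1..n}. CARD('a) - 1)"
      using card_proj_point[OF point[OF v]] by (intro prod.cong) auto
    finally show "card (Pi\<^sub>E {1..n} v) = (CARD('a) - 1) ^ n" by simp
  qed
  finally show ?thesis unfolding star_configs_eq_UN[OF assms] by simp
qed

section \<open>The order of PGL and the final count\<close>

lemma finite_carrier_mat: "finite (carrier_mat k k :: 'a::finite mat set)"
proof -
  have "(carrier_mat k k :: 'a mat set) \<subseteq> (\<lambda>f. mat k k f) ` (({..<k} \<times> {..<k}) \<rightarrow>\<^sub>E UNIV)"
  proof
    fix A :: "'a mat" assume "A \<in> carrier_mat k k"
    then have "A = mat k k (restrict (\<lambda>p. A $$ p) ({..<k} \<times> {..<k}))"
      by (intro eq_matI) auto
    then show "A \<in> (\<lambda>f. mat k k f) ` (({..<k} \<times> {..<k}) \<rightarrow>\<^sub>E UNIV)" by auto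
  qed
  then show ?thesis by (rule finite_subset) (intro finite_imageI finite_PiE, auto)
qed

text \<open>Lagrange's theorem for the subgroup of scalar matrices, which has order q - 1; for
  \<open>k \<ge> 1\<close> the entry \<open>(0, 0)\<close> tells the scalars apart.\<close>

lemma card_PGL:
  assumes "k \<ge> 1"
  shows "card (carrier (PGL TYPE('a::{field, finite}) k)) * (CARD('a) - 1) =
    card (gl_mats k :: 'a mat set)"
proof -
  let ?R = "ring_mat TYPE('a) k ()"
  let ?G = "units_of ?R"
  let ?H = "{c \<cdot>\<^sub>m 1\<^sub>m k |c. c \<noteq> (0 :: 'a)}"
  interpret R: ring ?R by (rule ring_mat)
  interpret G: group ?G by (rule R.units_group)
  have car: "carrier ?G = gl_mats k"
  proof (intro equalityI subsetI)
    fix A assume "A \<in> carrier ?G"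
    then have "A \<in> Units ?R" by (simp add: units_of_carrier)
    then show "A \<in> gl_mats k"
      using unit_imp_det_non_zero R.Units_closed[of A] by (simp add: gl_mats_def ring_mat_simps)
  next
    fix A :: "'a mat" assume "A \<in> gl_mats k"
    then show "A \<in> carrier ?G"
      using det_non_zero_imp_unit[of A k "()"] by (simp add: gl_mats_def units_of_carrier)
  qed
  have mult: "x \<otimes>\<^bsub>?G\<^esub> y = x * y" for x y by (simp add: units_of_mult ring_mat_simps)
  have one: "\<one>\<^bsub>?G\<^esub> = 1\<^sub>m k" by (simp add: units_of_one ring_mat_simps)
  have HG: "?H \<subseteq> carrier ?G" by (auto simp: car gl_mats_def)
  have prod: "(c \<cdot>\<^sub>m 1\<^sub>m k) * (d \<cdot>\<^sub>m 1\<^sub>m k) = (c * d) \<cdot>\<^sub>m 1\<^sub>m k" for c d :: 'a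
    by (simp add: mult_smult_assoc_mat[of _ k k _ k] mult_smult_distrib[of _ k k _ k])
      (auto intro!: eq_matI)
  have sub: "subgroup ?H ?G"
  proof (rule G.subgroupI)
    show "?H \<subseteq> carrier ?G" by (rule HG)
    show "?H \<noteq> {}" by (auto intro!: exI[of _ 1])
    fix x y assume "x \<in> ?H" "y \<in> ?H"
    then obtain c d where c: "x = c \<cdot>\<^sub>m 1\<^sub>m k" "c \<noteq> 0" and d: "y = d \<cdot>\<^sub>m 1\<^sub>m k" "d \<noteq> 0" by blast
    show "x \<otimes>\<^bsub>?G\<^esub> y \<in> ?H" using c d unfolding mult by (auto simp: prod)
    have inv: "inverse c \<cdot>\<^sub>m 1\<^sub>m k \<in> ?H" using c by auto
    have "(inverse c \<cdot>\<^sub>m 1\<^sub>m k) \<otimes>\<^bsub>?G\<^esub> x = \<one>\<^bsub>?G\<^esub>"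
      unfolding mult one using c by (simp add: prod) (auto intro!: eq_matI)
    then have "inv\<^bsub>?G\<^esub> x = inverse c \<cdot>\<^sub>m 1\<^sub>m k"
      using \<open>x \<in> ?H\<close> inv HG by (intro G.inv_equality) auto
    then show "inv\<^bsub>?G\<^esub> x \<in> ?H" using inv by simp
  qed
  have "inj_on (\<lambda>c. c \<cdot>\<^sub>m 1\<^sub>m k :: 'a mat) (UNIV - {0})"
  proof (rule inj_onI)
    fix c d :: 'a assume "c \<cdot>\<^sub>m 1\<^sub>m k = d \<cdot>\<^sub>m (1\<^sub>m k :: 'a mat)"
    from arg_cong[OF this, of "\<lambda>A. A $$ (0, 0)"] show "c = d" using assms by simp
  qed
  moreover have "?H = (\<lambda>c. c \<cdot>\<^sub>m 1\<^sub>m k) ` (UNIV - {0})" by auto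
  ultimately have "card ?H = CARD('a) - 1" by (simp add: card_image card_Diff_singleton)
  then show ?thesis
    using G.lagrange[OF sub] by (simp add: PGL_def FactGroup_def Coset.order_def car)
qed

lemma CARD_field_gt_1: "CARD('a::{field, finite}) > 1"
proof -
  have "card {0, 1 :: 'a} \<le> CARD('a)" by (rule card_mono) auto
  then show ?thesis by simp
qed

lemma card_tame_friezes:
  fixes k w n :: nat
  assumes k: "k \<ge> 1" and n: "n = w + k + 1"
  shows "finite (tame_friezes k w :: (int \<Rightarrow> int \<Rightarrow> 'a::{field, finite}) set)"
    and "card (tame_friezes k w :: (int \<Rightarrow> int \<Rightarrow> 'a) set) * card (carrier (PGL TYPE('a) k)) =
      card (Ck_star k n :: (nat \<Rightarrow> 'a vec set) set) * (CARD('a) - 1) ^ (gcd k n - 1)"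
    and "card (carrier (PGL TYPE('a) k)) > 0"
proof -
  let ?F = "tame_friezes k w :: (int \<Rightarrow> int \<Rightarrow> 'a) set"
  let ?N = "normal_configs k n :: (nat \<Rightarrow> 'a vec) set"
  let ?q = "CARD('a) - 1"
  have n0: "n > 0" "k \<le> n" using n by auto
  have q: "?q > 0" using CARD_field_gt_1[where 'a = 'a] by simp
  have finN: "finite ?N"
    by (rule finite_subset[OF _ finite_PiE[of "{1..n}" "\<lambda>_. carrier_vec k"]])
      (auto simp: normal_configs_def finite_carrier_vec)
  note bij = bij_betw_seq_frieze[OF k n, where 'a = 'a]
  show "finite ?F" using bij_betw_finite[OF bij] finN by simp
  \<comment> \<open>Both sides equal (q - 1)^n times the number of constant configurations; the
    factor (q - 1)^n on the right comes from the lifts of each point tuple.\<close>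
  have "?q ^ n * (card (gl_mats k :: 'a mat set) * card ?F) = ?q ^ n * (?q ^ gcd k n * card (Ck_star k n :: (nat \<Rightarrow> 'a vec set) set))"
    using card_const_configs_star_configs[OF n0(1), of k, where 'a = 'a]
      bij_betw_same_card[OF bij_betw_const_configs[OF n0(2,1), where 'a = 'a]]
      bij_betw_same_card[OF bij] card_star_configs[OF k n0(1), where 'a = 'a]
    by (simp add: card_cartesian_product mult.left_commute)
  then have "card (gl_mats k :: 'a mat set) * card ?F = ?q ^ gcd k n * card (Ck_star k n :: (nat \<Rightarrow> 'a vec set) set)"
    using q by simp
  moreover have "?q ^ gcd k n = ?q * ?q ^ (gcd k n - 1)"
    using n0 by (metis gcd_nat.eq_neutr_iff gcd_pos_nat less_irrefl power_eq_if)
  ultimately have "?q * (card ?F * card (carrier (PGL TYPE('a) k))) =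
      ?q * (card (Ck_star k n :: (nat \<Rightarrow> 'a vec set) set) * ?q ^ (gcd k n - 1))"
    using card_PGL[OF k, where 'a = 'a] by (simp add: mult.commute mult.left_commute)
  then show "card ?F * card (carrier (PGL TYPE('a) k)) =
      card (Ck_star k n :: (nat \<Rightarrow> 'a vec set) set) * ?q ^ (gcd k n - 1)"
    using q by simp
  have "(1\<^sub>m k :: 'a mat) \<in> gl_mats k" by (simp add: gl_mats_def)
  moreover have "finite (gl_mats k :: 'a mat set)"
    by (rule finite_subset[OF _ finite_carrier_mat[of k]]) (auto simp: gl_mats_def)
  ultimately have "card (gl_mats k :: 'a mat set) > 0" using card_gt_0_iff by blast
  then show "card (carrier (PGL TYPE('a) k)) > 0"
    using card_PGL[OF k, where 'a = 'a] by (metis gr0I mult_0)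
qed

text \<open>The balance condition is vacuous here, so only the existence of a lift remains, and
  points of projective space are nonempty.\<close>

lemma Ck_star_eq_Ck:
  assumes "gcd k n = 1"
  shows "Ck_star k n = Ck k n"
proof -
  have "\<exists>V. is_lift n v V" if "v \<in> Ck k n" for v :: "nat \<Rightarrow> 'a vec set"
  proof -
    have "\<forall>i\<in>{1..n}. v i \<noteq> {}"
      using that in_quotient_imp_non_empty[OF equiv_proj_rel]
      by (auto simp: Ck_def PiE_iff proj_space_def)
    then show ?thesis
      unfolding is_lift_def by (intro exI[of _ "\<lambda>i. SOME x. x \<in> v i"]) (auto simp: some_in_eq)
  qed
  then show ?thesis using assms by (auto simp: Ck_star_def)
qed

theorem theorem2p16:
  fixes k w n g q :: nat
  assumes "k \<ge> 2" and "w \<ge> 1"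
    and "n = w + k + 1" and "g = gcd k n"
    and "q = CARD('a::{field, finite})"
  shows "(g = 1 \<longrightarrow>
            finite (tame_friezes k w :: (int \<Rightarrow> int \<Rightarrow> 'a) set) \<and>
            real (card (tame_friezes k w :: (int \<Rightarrow> int \<Rightarrow> 'a) set)) =
              real (card (Ck k n :: (nat \<Rightarrow> 'a vec set) set)) / real (card (carrier (PGL TYPE('a) k)))) \<and>
         (g > 1 \<longrightarrow>
            finite (tame_friezes k w :: (int \<Rightarrow> int \<Rightarrow> 'a) set) \<and>
            real (card (tame_friezes k w :: (int \<Rightarrow> int \<Rightarrow> 'a) set)) =
              real (card (Ck_star k n :: (nat \<Rightarrow> 'a vec set) set)) * (real q - 1) ^ (g - 1)
                / real (card (carrier (PGL TYPE('a) k))))"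
proof -
  have k: "k \<ge> 1" using assms(1) by simp
  note count = card_tame_friezes[OF k assms(3), where 'a = 'a]
  have "real (card (tame_friezes k w :: (int \<Rightarrow> int \<Rightarrow> 'a) set)) * real (card (carrier (PGL TYPE('a) k))) =
      real (card (Ck_star k n :: (nat \<Rightarrow> 'a vec set) set) * (CARD('a) - 1) ^ (gcd k n - 1))"
    using count(2) by (metis of_nat_mult)
  also have "\<dots> = real (card (Ck_star k n :: (nat \<Rightarrow> 'a vec set) set)) * (real q - 1) ^ (g - 1)"
    using CARD_field_gt_1[where 'a = 'a] assms(4,5) by (simp add: of_nat_diff)
  finally have "real (card (tame_friezes k w :: (int \<Rightarrow> int \<Rightarrow> 'a) set)) =
      real (card (Ck_star k n :: (nat \<Rightarrow> 'a vec set) set)) * (real q - 1) ^ (g - 1)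
        / real (card (carrier (PGL TYPE('a) k)))"
    using count(3) by (simp add: field_simps)
  then show ?thesis using count(1) Ck_star_eq_Ck[of k n, where 'a = 'a] assms(4) by auto
qed

end
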